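(* Let $\alpha=\alpha(n)\ge1$ be an approximation factor. For $n\times n$ real matrices: for every $p\in[1,\infty]$ there exists an $\big(O(n^2/\alpha),\alpha\big)$-sketching family for the $2\to p$ norm and for the $\infty\to p$ norm; and for every $q\ge1$ and $1\le p\le2$ there exists an $\big(O(n^2/\alpha^2),\alpha\big)$-sketching family for the $q\to p$ norm.
   Context: For $A\in\mathbb{R}^{n\times d}$ and $p,q\in[1,\infty]$, $\|A\|_{q\to p}=\sup_{x\ne0}\frac{\|Ax\|_p}{\|x\|_q}$. A $(k,\alpha)$-sketching family for the $q\to p$ norm is a pair $(\mathcal{S},f)$ where $\mathcal{S}$ is a distribution over linear maps $L:\mathbb{R}^{n\times d}\to\mathbb{R}^k$ and $f:\mathbb{R}^k\to\mathbb{R}$, such that for every $A$, $\Pr_{L\sim\mathcal{S}}\big[f(L(A))\in(\tfrac1\alpha\|A\|_{q\to p},\,\alpha\|A\|_{q\to p})\big]\ge \frac56$.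
   Formalization: Where the open interval (‖A‖/α, α‖A‖) is empty (A = 0 or α = 1), the estimate must equal ‖A‖ exactly; and the sketch dimension bounds O(n²/α), O(n²/α²) are read as at least 1, since dimension 0 is impossible. *)

theory Defs
  imports "HOL-Probability.Probability" "Jordan_Normal_Form.Matrix"
begin

text \<open>Matrices and vectors are those of Jordan_Normal_Form, whose dimensions are ordinary
  natural numbers; the dollar notation of HOL-Analysis is switched off in favour of theirs.\<close>

unbundle no vec_syntax

text \<open>The exponent ranges over [1, \<infinity>], so it is an extended real. For p = \<infinity> the vector must
  have positive dimension.\<close>

definition lp_norm :: "ereal \<Rightarrow> real vec \<Rightarrow> real" where
  "lp_norm p x =
     (if p = \<infinity> then Max ((\<lambda>i. \<bar>x $ i\<bar>) ` {..<dim_vec x})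
      else (\<Sum>i<dim_vec x. \<bar>x $ i\<bar> powr real_of_ereal p) powr (1 / real_of_ereal p))"

definition op_norm :: "ereal \<Rightarrow> ereal \<Rightarrow> real mat \<Rightarrow> real" where
  "op_norm q p A =
     (SUP x \<in> carrier_vec (dim_col A) - {0\<^sub>v (dim_col A)}. lp_norm p (A *\<^sub>v x) / lp_norm q x)"

text \<open>Linear maps are functions on the carrier, undefined outside it (hence the extensional
  function space), so that distinct elements of this set are distinct linear maps.\<close>

definition linear_maps :: "nat \<Rightarrow> nat \<Rightarrow> nat \<Rightarrow> (real mat \<Rightarrow> real vec) set" where
  "linear_maps n d k =
     {L \<in> carrier_mat n d \<rightarrow>\<^sub>E carrier_vec k.
        (\<forall>A \<in> carrier_mat n d. \<forall>B \<in> carrier_mat n d. L (A + B) = L A + L B) \<and>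
        (\<forall>c. \<forall>A \<in> carrier_mat n d. L (c \<cdot>\<^sub>m A) = c \<cdot>\<^sub>v L A)}"

text \<open>The Borel sigma-algebra of the finite-dimensional space of linear maps: the one generated
  by the evaluations of the coordinates of L A. Only its space and its sets matter; the measure
  that sigma attaches to it is not used.\<close>

definition linear_maps_borel :: "nat \<Rightarrow> nat \<Rightarrow> nat \<Rightarrow> (real mat \<Rightarrow> real vec) measure" where
  "linear_maps_borel n d k =
     sigma (linear_maps n d k)
       {{L \<in> linear_maps n d k. L A $ j \<in> U} | A j U.
          A \<in> carrier_mat n d \<and> j < k \<and> U \<in> sets borel}"

text \<open>The open interval (v / \<alpha>, \<alpha> v) is empty if v = 0 or \<alpha> = 1. In these degenerate
  cases the only sensible target, f (L A) = v exactly, takes its place.\<close>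

definition approx_interval :: "real \<Rightarrow> real \<Rightarrow> real set" where
  "approx_interval \<alpha> v = (if v = 0 \<or> \<alpha> = 1 then {v} else {v / \<alpha><..<\<alpha> * v})"

text \<open>The map f is an arbitrary function. No measurability has to be demanded separately: a
  non-measurable event has measure 0, so the lower bound 5/6 forces the event to be measurable.\<close>

definition sketching_family ::
  "nat \<Rightarrow> nat \<Rightarrow> nat \<Rightarrow> real \<Rightarrow> ereal \<Rightarrow> ereal \<Rightarrow>
   (real mat \<Rightarrow> real vec) measure \<Rightarrow> (real vec \<Rightarrow> real) \<Rightarrow> bool" where
  "sketching_family n d k \<alpha> q p S f \<longleftrightarrow>
     prob_space S \<and> sets S = sets (linear_maps_borel n d k) \<and>
     (\<forall>A \<in> carrier_mat n d.
        measure S {L \<in> space S. f (L A) \<in> approx_interval \<alpha> (op_norm q p A)} \<ge> 5 / 6)"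

end

theory Submission
  imports Defs
begin

text \<open>
  A matrix A is sketched by S A T, where S replaces each block of m rows by a random linear
  combination of its rows and T does the same with blocks of b columns; the estimate is a multiple
  of the operator norm of S A T. The coefficients are independent and uniform on
  {0, \<dots>, 23}. Because they are bounded, the power mean inequality bounds the norm of S A T
  by a constant times m powr (1 - 1/p) * b powr (1/q) times the norm of A, with certainty.

  Conversely, a block sum of y is smaller than half of a fixed coordinate of the block with
  probability at most 1/24, so by Markov's inequality half of the mass of y survives. Applied to
  y = A x for a nearly optimal x, this bounds the norm of S A from below by a constant times
  m powr (-1/p) times the norm of A. If S A is a single row, the same argument with the weights given
  by the products of its entries with those of x bounds the loss under T by b powr (1/q - 1). No
  duality is needed here, because a vector that is constant up to sign on each block of columns can
  align the signs of all terms.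

  The total distortion is a constant times m * b, while the interval from v / \<alpha> to \<alpha> v
  leaves room for a factor \<alpha>^2. So m * b of order \<alpha>^2 is admissible for all exponents, and
  the sketch has about n^2 / (m * b) coordinates. Row blocks suffice if \<alpha>^2 is at most of order n;
  otherwise m = n, and S A is indeed a single row.
\<close>

section \<open>Norms\<close>

lemma lp_norm_ereal:
  "lp_norm (ereal P) x = (\<Sum>i<dim_vec x. \<bar>x $ i\<bar> powr P) powr (1 / P)"
  by (simp add: lp_norm_def)

lemma abs_index_le_lp_norm:
  assumes "1 \<le> p" "i < dim_vec x"
  shows "\<bar>x $ i\<bar> \<le> lp_norm p x"
proof (cases "p = \<infinity>")
  case True
  then show ?thesis using assms by (auto simp: lp_norm_def intro!: Max_ge)
next
  case False
  then obtain P where P: "p = ereal P" "P \<ge> 1"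
    using assms(1) by (cases p) (auto simp: one_ereal_def)
  have "\<bar>x $ i\<bar> powr P \<le> (\<Sum>i<dim_vec x. \<bar>x $ i\<bar> powr P)"
    using assms(2) by (intro member_le_sum) auto
  then have "(\<bar>x $ i\<bar> powr P) powr (1 / P) \<le> lp_norm p x"
    unfolding P lp_norm_ereal using P(2) by (intro powr_mono2) auto
  then show ?thesis using P(2) by (simp add: powr_powr)
qed

lemma lp_norm_nonneg:
  assumes "1 \<le> p" "0 < dim_vec x"
  shows "0 \<le> lp_norm p x"
  using abs_index_le_lp_norm[OF assms] by linarith

lemma lp_norm_pos:
  assumes "1 \<le> p" "x \<in> carrier_vec d - {0\<^sub>v d}"
  shows "0 < lp_norm p x"
proof -
  obtain i where i: "i < dim_vec x" "x $ i \<noteq> 0"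
    using assms(2) eq_vecI[of x "0\<^sub>v d"] by fastforce
  then show ?thesis using abs_index_le_lp_norm[OF assms(1) i(1)] by linarith
qed

text \<open>The factor \<open>dim_vec x\<close> is crude but uniform in the exponent. It suffices to
  show that operator norms are finite, and it is sharp in dimension 1, where a matrix with a single
  row puts its products.\<close>

lemma lp_norm_le_of_bound:
  assumes "1 \<le> p" "0 < dim_vec x" "\<And>i. i < dim_vec x \<Longrightarrow> \<bar>x $ i\<bar> \<le> B"
  shows "lp_norm p x \<le> real (dim_vec x) * B"
proof -
  have B0: "0 \<le> B" using assms(3)[OF assms(2)] by linarith
  have d1: "1 \<le> real (dim_vec x)" using assms(2) by linarith
  show ?thesis
  proof (cases "p = \<infinity>")
    case True
    have "lp_norm p x \<le> B"
      unfolding lp_norm_def if_P[OF True] using assms(2,3)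
      by (intro Max.boundedI) (auto simp: lessThan_empty_iff)
    also have "\<dots> \<le> real (dim_vec x) * B" using mult_right_mono[OF d1 B0] by simp
    finally show ?thesis .
  next
    case False
    then obtain P where P: "p = ereal P" "P \<ge> 1"
      using assms(1) by (cases p) (auto simp: one_ereal_def)
    have "(\<Sum>i<dim_vec x. \<bar>x $ i\<bar> powr P) \<le> (\<Sum>i<dim_vec x. B powr P)"
      using assms(3) P by (intro sum_mono powr_mono2) auto
    then have "lp_norm p x \<le> (real (dim_vec x) * B powr P) powr (1 / P)"
      unfolding P lp_norm_ereal using P(2) by (intro powr_mono2) (auto intro: sum_nonneg)
    also have "\<dots> = real (dim_vec x) powr (1 / P) * B"
      using B0 P by (simp add: powr_mult powr_powr)
    also have "\<dots> \<le> real (dim_vec x) powr 1 * B"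
      using B0 P d1 by (intro mult_right_mono powr_mono) auto
    finally show ?thesis using d1 by simp
  qed
qed

lemma lp_norm_zero:
  assumes "1 \<le> p" "0 < d"
  shows "lp_norm p (0\<^sub>v d) = 0"
  using lp_norm_le_of_bound[of p "0\<^sub>v d" 0] lp_norm_nonneg[of p "0\<^sub>v d"] assms by simp

section \<open>Boundedness and nearly extremal vectors of the operator norm\<close>

text \<open>The real supremum in \<open>op_norm\<close> obeys the usual laws only on bounded
  nonempty sets. A bound comes from the sum \<open>B\<close> of the absolute values of all entries,
  since every coordinate of \<open>x\<close> is at most \<open>lp_norm q x\<close>.\<close>

lemma op_norm_bdd_above:
  assumes "1 \<le> p" "1 \<le> q" "0 < dim_row A"
  shows "bdd_above ((\<lambda>x. lp_norm p (A *\<^sub>v x) / lp_norm q x) `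
           (carrier_vec (dim_col A) - {0\<^sub>v (dim_col A)}))"
proof (rule bdd_aboveI2)
  fix x :: "real vec" assume x: "x \<in> carrier_vec (dim_col A) - {0\<^sub>v (dim_col A)}"
  then have xd: "dim_vec x = dim_col A" by simp
  define B where "B = (\<Sum>i<dim_row A. \<Sum>j<dim_col A. \<bar>A $$ (i,j)\<bar>)"
  have "\<bar>(A *\<^sub>v x) $ i\<bar> \<le> B * lp_norm q x" if i: "i < dim_vec (A *\<^sub>v x)" for i
  proof -
    have "\<bar>(A *\<^sub>v x) $ i\<bar> = \<bar>\<Sum>j<dim_col A. A $$ (i,j) * x $ j\<bar>"
      using i xd by (simp add: scalar_prod_def atLeast0LessThan)
    also have "\<dots> \<le> (\<Sum>j<dim_col A. \<bar>A $$ (i,j)\<bar> * lp_norm q x)"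
    proof (intro order_trans[OF sum_abs] sum_mono)
      fix j assume "j \<in> {..<dim_col A}"
      then have "\<bar>x $ j\<bar> \<le> lp_norm q x" using abs_index_le_lp_norm[OF assms(2)] xd by simp
      then show "\<bar>A $$ (i,j) * x $ j\<bar> \<le> \<bar>A $$ (i,j)\<bar> * lp_norm q x"
        by (simp add: abs_mult mult_left_mono)
    qed
    also have "\<dots> = (\<Sum>j<dim_col A. \<bar>A $$ (i,j)\<bar>) * lp_norm q x"
      by (simp add: sum_distrib_right)
    also have "\<dots> \<le> B * lp_norm q x"
    proof (rule mult_right_mono)
      show "(\<Sum>j<dim_col A. \<bar>A $$ (i,j)\<bar>) \<le> B"
        using i unfolding B_def
        by (intro member_le_sum[where f = "\<lambda>i. \<Sum>j<dim_col A. \<bar>A $$ (i,j)\<bar>"]) (auto intro: sum_nonneg)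
      show "0 \<le> lp_norm q x" using lp_norm_pos[OF assms(2) x] by simp
    qed
    finally show ?thesis .
  qed
  then have "lp_norm p (A *\<^sub>v x) \<le> real (dim_row A) * (B * lp_norm q x)"
    using lp_norm_le_of_bound[of p "A *\<^sub>v x"] assms by auto
  then show "lp_norm p (A *\<^sub>v x) / lp_norm q x \<le> real (dim_row A) * B"
    using lp_norm_pos[OF assms(2) x] by (simp add: divide_le_eq mult_ac)
qed

lemma nonzero_vec_exists:
  assumes "0 < d"
  shows "(carrier_vec d :: real vec set) - {0\<^sub>v d} \<noteq> {}"
proof -
  have "vec d (\<lambda>_. 1 :: real) \<noteq> 0\<^sub>v d"
  proof
    assume "vec d (\<lambda>_. 1 :: real) = 0\<^sub>v d"
    then have "vec d (\<lambda>_. 1 :: real) $ 0 = 0\<^sub>v d $ 0" by simp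
    then show False using assms by simp
  qed
  then have "vec d (\<lambda>_. 1 :: real) \<in> carrier_vec d - {0\<^sub>v d}" by simp
  then show ?thesis by blast
qed

lemma lp_norm_mult_le_op_norm:
  assumes "1 \<le> p" "1 \<le> q" "A \<in> carrier_mat r d" "0 < r" "0 < d" "x \<in> carrier_vec d"
  shows "lp_norm p (A *\<^sub>v x) \<le> op_norm q p A * lp_norm q x"
proof (cases "x = 0\<^sub>v d")
  case True
  then have "A *\<^sub>v x = 0\<^sub>v r" using assms by (intro eq_vecI) auto
  then show ?thesis using True assms by (simp add: lp_norm_zero)
next
  case False
  then have x: "x \<in> carrier_vec d - {0\<^sub>v d}" using assms by auto
  have "lp_norm p (A *\<^sub>v x) / lp_norm q x \<le> op_norm q p A"
    unfolding op_norm_def using op_norm_bdd_above[of p q A] assms x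
    by (intro cSUP_upper) auto
  then show ?thesis using lp_norm_pos[OF assms(2) x] by (simp add: divide_le_eq)
qed

lemma op_norm_le:
  fixes A :: "real mat"
  assumes "1 \<le> q" "A \<in> carrier_mat r d" "0 < d"
    "\<And>x. x \<in> carrier_vec d \<Longrightarrow> lp_norm p (A *\<^sub>v x) \<le> c * lp_norm q x"
  shows "op_norm q p A \<le> c"
  unfolding op_norm_def
proof (rule cSUP_least)
  show "(carrier_vec (dim_col A) :: real vec set) - {0\<^sub>v (dim_col A)} \<noteq> {}"
    using nonzero_vec_exists[OF assms(3)] unfolding carrier_matD(2)[OF assms(2)] .
  fix x :: "real vec" assume "x \<in> carrier_vec (dim_col A) - {0\<^sub>v (dim_col A)}"
  then have x: "x \<in> carrier_vec d - {0\<^sub>v d}" using assms by auto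
  show "lp_norm p (A *\<^sub>v x) / lp_norm q x \<le> c"
    using assms(4)[of x] x lp_norm_pos[OF assms(1) x] by (simp add: divide_le_eq)
qed

lemma op_norm_nonneg:
  assumes "1 \<le> p" "1 \<le> q" "A \<in> carrier_mat r d" "0 < r" "0 < d"
  shows "0 \<le> op_norm q p A"
proof -
  obtain x where x: "x \<in> carrier_vec d - {0\<^sub>v d :: real vec}" using nonzero_vec_exists[OF assms(5)] by auto
  have "0 \<le> lp_norm p (A *\<^sub>v x)" using assms by (intro lp_norm_nonneg) auto
  also have "\<dots> \<le> op_norm q p A * lp_norm q x" using lp_norm_mult_le_op_norm[OF assms] x by auto
  finally show ?thesis using lp_norm_pos[OF assms(2) x] by (simp add: zero_le_mult_iff)
qed

text \<open>Free of suprema and quotients, this form serves two purposes: it yields nearly optimal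
  vectors, and it writes the superlevel sets of the norm as unions over \<open>x\<close>.\<close>

lemma less_op_norm_iff:
  assumes "1 \<le> p" "1 \<le> q" "A \<in> carrier_mat r d" "0 < r" "0 < d"
  shows "t < op_norm q p A \<longleftrightarrow>
    (\<exists>x \<in> carrier_vec d - {0\<^sub>v d}. t * lp_norm q x < lp_norm p (A *\<^sub>v x))"
proof -
  have "t < op_norm q p A \<longleftrightarrow>
    (\<exists>x \<in> carrier_vec d - {0\<^sub>v d}. t < lp_norm p (A *\<^sub>v x) / lp_norm q x)"
    unfolding op_norm_def using op_norm_bdd_above[of p q A] assms nonzero_vec_exists[OF assms(5)]
    by (subst less_cSUP_iff) auto
  also have "\<dots> \<longleftrightarrow> (\<exists>x \<in> carrier_vec d - {0\<^sub>v d}. t * lp_norm q x < lp_norm p (A *\<^sub>v x))"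
    by (intro bex_cong refl pos_less_divide_eq lp_norm_pos[OF assms(2)])
  finally show ?thesis .
qed

text \<open>A positive supremum exceeds its half, so some vector does too; if the norm is 0, any
  nonzero vector will do. The loss of 2 goes into the constants.\<close>

lemma op_norm_half_attained:
  assumes "1 \<le> p" "1 \<le> q" "A \<in> carrier_mat r d" "0 < r" "0 < d"
  obtains x where "x \<in> carrier_vec d - {0\<^sub>v d}"
    "op_norm q p A / 2 * lp_norm q x \<le> lp_norm p (A *\<^sub>v x)"
proof (cases "op_norm q p A = 0")
  case True
  obtain x where x: "x \<in> carrier_vec d - {0\<^sub>v d :: real vec}" using nonzero_vec_exists[OF assms(5)] by auto
  moreover have "0 \<le> lp_norm p (A *\<^sub>v x)" using assms by (intro lp_norm_nonneg) auto
  ultimately show ?thesis using that True by simp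
next
  case False
  then have "op_norm q p A / 2 < op_norm q p A" using op_norm_nonneg[OF assms] by linarith
  then show ?thesis using that by (auto simp: less_op_norm_iff[OF assms] intro: less_imp_le)
qed

text \<open>A factor on the left acts on the output of \<open>A\<close>, so its norm from p to p
  governs the change; a factor on the right acts on the input and is governed by its norm from q to
  q.\<close>

lemma op_norm_mult_left_le:
  assumes "1 \<le> p" "1 \<le> q" "A \<in> carrier_mat r d" "0 < r" "0 < d" "S \<in> carrier_mat s r" "0 \<le> c"
    "\<And>y. y \<in> carrier_vec r \<Longrightarrow> lp_norm p (S *\<^sub>v y) \<le> c * lp_norm p y"
  shows "op_norm q p (S * A) \<le> c * op_norm q p A"
proof (rule op_norm_le)
  show "S * A \<in> carrier_mat s d" using assms by auto
  fix x :: "real vec" assume x: "x \<in> carrier_vec d"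
  have "lp_norm p (S * A *\<^sub>v x) = lp_norm p (S *\<^sub>v (A *\<^sub>v x))" using assms x by simp
  also have "\<dots> \<le> c * lp_norm p (A *\<^sub>v x)" using assms x by auto
  also have "\<dots> \<le> c * (op_norm q p A * lp_norm q x)"
    using assms x by (intro mult_left_mono lp_norm_mult_le_op_norm) auto
  finally show "lp_norm p (S * A *\<^sub>v x) \<le> c * op_norm q p A * lp_norm q x" by (simp add: mult_ac)
qed (use assms in auto)

lemma op_norm_mult_right_le:
  assumes "1 \<le> p" "1 \<le> q" "A \<in> carrier_mat r d" "0 < r" "0 < d" "0 < s" "T \<in> carrier_mat d s"
    "\<And>z. z \<in> carrier_vec s \<Longrightarrow> lp_norm q (T *\<^sub>v z) \<le> c * lp_norm q z"
  shows "op_norm q p (A * T) \<le> c * op_norm q p A"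
proof (rule op_norm_le)
  show "A * T \<in> carrier_mat r s" using assms by auto
  fix x :: "real vec" assume x: "x \<in> carrier_vec s"
  have "lp_norm p (A * T *\<^sub>v x) = lp_norm p (A *\<^sub>v (T *\<^sub>v x))" using assms x by simp
  also have "\<dots> \<le> op_norm q p A * lp_norm q (T *\<^sub>v x)"
    using assms x by (intro lp_norm_mult_le_op_norm[where r = r and d = d]) auto
  also have "\<dots> \<le> op_norm q p A * (c * lp_norm q x)"
    using assms x by (intro mult_left_mono op_norm_nonneg[where r = r and d = d]) auto
  finally show "lp_norm p (A * T *\<^sub>v x) \<le> c * op_norm q p A * lp_norm q x" by (simp add: mult_ac)
qed (use assms in auto)

text \<open>In dimension n the norm for p = \<infinity> is within a factor n powr (1 / n) \<le> 2 of the norm for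
  p = n, so that the estimates below need to treat finite exponents only.\<close>

definition finite_exponent :: "nat \<Rightarrow> ereal \<Rightarrow> real" where
  "finite_exponent n p = (if p = \<infinity> then real n else real_of_ereal p)"

lemma finite_exponent_ge_1:
  assumes "1 \<le> p" "1 \<le> n"
  shows "1 \<le> finite_exponent n p"
  using assms by (cases p) (auto simp: finite_exponent_def one_ereal_def)

lemma lp_norm_finite_exponent:
  assumes "1 \<le> p" "x \<in> carrier_vec n" "1 \<le> n"
  shows "lp_norm p x \<le> lp_norm (ereal (finite_exponent n p)) x"
    and "lp_norm (ereal (finite_exponent n p)) x \<le> 2 * lp_norm p x"
proof -
  have "lp_norm p x \<le> lp_norm (ereal (finite_exponent n p)) x \<and>
    lp_norm (ereal (finite_exponent n p)) x \<le> 2 * lp_norm p x"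
  proof (cases "p = \<infinity>")
    case True
    have d: "dim_vec x = n" using assms by auto
    have "Max ((\<lambda>i. \<bar>x $ i\<bar>) ` {..<dim_vec x}) \<in> (\<lambda>i. \<bar>x $ i\<bar>) ` {..<dim_vec x}"
      using assms d by (intro Max_in) (auto simp: lessThan_empty_iff)
    then have "lp_norm p x \<in> (\<lambda>i. \<bar>x $ i\<bar>) ` {..<dim_vec x}"
      by (simp only: lp_norm_def if_P[OF True])
    then have "lp_norm p x \<le> lp_norm (ereal (finite_exponent n p)) x"
      using finite_exponent_ge_1[OF assms(1,3)] by (auto intro!: abs_index_le_lp_norm simp: one_ereal_def)
    moreover have "lp_norm (ereal (real n)) x \<le> 2 * lp_norm p x"
    proof -
      have nn: "0 \<le> lp_norm p x" using assms d by (intro lp_norm_nonneg) auto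
      have "(\<Sum>i<dim_vec x. \<bar>x $ i\<bar> powr real n) \<le> (\<Sum>i<dim_vec x. lp_norm p x powr real n)"
        using assms by (intro sum_mono powr_mono2 abs_index_le_lp_norm) auto
      then have "(\<Sum>i<dim_vec x. \<bar>x $ i\<bar> powr real n) \<le> real n * lp_norm p x powr real n"
        using d by simp
      \<comment> \<open>This is \<open>n powr (1 / n) \<le> 2\<close> before taking roots, that is,
        \<open>n \<le> 2 ^ n\<close>.\<close>
      also have "\<dots> \<le> 2 powr real n * lp_norm p x powr real n"
        by (intro mult_right_mono) (auto simp: powr_realpow less_imp_le of_nat_less_two_power)
      finally have "lp_norm (ereal (real n)) x \<le> (2 powr real n * lp_norm p x powr real n) powr (1 / real n)"
        unfolding lp_norm_ereal by (intro powr_mono2) (auto intro: sum_nonneg)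
      also have "\<dots> = 2 * lp_norm p x"
        using nn assms by (simp add: powr_mult powr_powr)
      finally show ?thesis .
    qed
    ultimately show ?thesis using True by (simp add: finite_exponent_def)
  next
    case False
    then have "ereal (finite_exponent n p) = p"
      using assms(1) by (cases p) (auto simp: finite_exponent_def)
    moreover have "0 \<le> lp_norm p x" using assms by (intro lp_norm_nonneg) auto
    ultimately show ?thesis by simp
  qed
  then show "lp_norm p x \<le> lp_norm (ereal (finite_exponent n p)) x"
    and "lp_norm (ereal (finite_exponent n p)) x \<le> 2 * lp_norm p x" by auto
qed

text \<open>In either direction only one of the two changes of exponent costs a factor 2, the other
  being monotone. So the total loss is 2 and not 4.\<close>

lemma op_norm_finite_exponent:
  assumes "1 \<le> p" "1 \<le> q" "A \<in> carrier_mat n n" "1 \<le> n"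
  defines "p' \<equiv> ereal (finite_exponent n p)" and "q' \<equiv> ereal (finite_exponent n q)"
  shows "op_norm q p A \<le> 2 * op_norm q' p' A" and "op_norm q' p' A \<le> 2 * op_norm q p A"
proof -
  have p': "1 \<le> p'" "1 \<le> q'"
    using finite_exponent_ge_1 assms unfolding p'_def q'_def by (auto simp: one_ereal_def)
  have n0: "0 < n" using assms by simp
  show "op_norm q p A \<le> 2 * op_norm q' p' A"
  proof (rule op_norm_le[OF assms(2,3) n0])
    fix x :: "real vec" assume x: "x \<in> carrier_vec n"
    have "lp_norm p (A *\<^sub>v x) \<le> lp_norm p' (A *\<^sub>v x)"
      unfolding p'_def using x assms by (intro lp_norm_finite_exponent) auto
    also have "\<dots> \<le> op_norm q' p' A * lp_norm q' x"
      by (rule lp_norm_mult_le_op_norm[OF p' assms(3) n0 n0 x])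
    also have "\<dots> \<le> op_norm q' p' A * (2 * lp_norm q x)"
      unfolding q'_def using x assms p' n0
      by (intro mult_left_mono lp_norm_finite_exponent op_norm_nonneg[where r = n and d = n]) (auto simp: q'_def p'_def)
    finally show "lp_norm p (A *\<^sub>v x) \<le> 2 * op_norm q' p' A * lp_norm q x" by simp
  qed
  show "op_norm q' p' A \<le> 2 * op_norm q p A"
  proof (rule op_norm_le[OF p'(2) assms(3) n0])
    fix x :: "real vec" assume x: "x \<in> carrier_vec n"
    have "lp_norm p' (A *\<^sub>v x) \<le> 2 * lp_norm p (A *\<^sub>v x)"
      unfolding p'_def using x assms by (intro lp_norm_finite_exponent) auto
    also have "\<dots> \<le> 2 * (op_norm q p A * lp_norm q x)"
      using lp_norm_mult_le_op_norm[OF assms(1-3) n0 n0 x] by simp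
    also have "\<dots> \<le> 2 * (op_norm q p A * lp_norm q' x)"
      unfolding q'_def using x assms n0
      by (intro mult_left_mono lp_norm_finite_exponent op_norm_nonneg[where r = n and d = n]) auto
    finally show "lp_norm p' (A *\<^sub>v x) \<le> 2 * op_norm q p A * lp_norm q' x" by simp
  qed
qed

section \<open>Sketches with finitely many outcomes\<close>

definition unflatten :: "nat \<Rightarrow> nat \<Rightarrow> real vec \<Rightarrow> real mat" where
  "unflatten r s w = mat r s (\<lambda>(i, j). w $ (i * s + j))"

text \<open>Sketches take values in vectors, so S A T is written out row by row;
  \<open>unflatten\<close> reverses this. The restriction to the carrier makes the map extensional,
  as \<open>linear_maps\<close> demands.\<close>

definition sketch_map :: "nat \<Rightarrow> real mat \<Rightarrow> real mat \<Rightarrow> real mat \<Rightarrow> real vec" where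
  "sketch_map n S T = (\<lambda>A\<in>carrier_mat n n.
     vec (dim_row S * dim_col T) (\<lambda>l. (S * A * T) $$ (l div dim_col T, l mod dim_col T)))"

lemma div_mod_less_times:
  fixes l r s :: nat
  assumes "l < r * s"
  shows "l div s < r" "l mod s < s"
  using assms by (auto simp: less_mult_imp_div_less intro!: mod_less_divisor) (metis gr_zeroI mult_0_right not_less0)

lemma mult_add_less_times:
  fixes i j r s :: nat
  assumes "i < r" "j < s"
  shows "i * s + j < r * s"
  using assms by (metis add_less_cancel_left less_le_trans mult_Suc_right mult.commute Suc_leI mult_le_mono2 add.commute)

lemma sketch_map_linear:
  assumes S: "S \<in> carrier_mat r n" and T: "T \<in> carrier_mat n s"
  shows "sketch_map n S T \<in> linear_maps n n (r * s)"
proof -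
  have d: "dim_row S = r" "dim_col T = s" using S T by auto
  have add: "S * (A + B) * T = S * A * T + S * B * T"
    if A: "A \<in> carrier_mat n n" and B: "B \<in> carrier_mat n n" for A B
  proof -
    have "S * (A + B) * T = (S * A + S * B) * T"
      by (simp only: mult_add_distrib_mat[OF S A B])
    also have "\<dots> = S * A * T + S * B * T"
      by (rule add_mult_distrib_mat[OF mult_carrier_mat[OF S A] mult_carrier_mat[OF S B] T])
    finally show ?thesis .
  qed
  have smult: "S * (c \<cdot>\<^sub>m A) * T = c \<cdot>\<^sub>m (S * A * T)" if A: "A \<in> carrier_mat n n" for c A
    by (simp only: mult_smult_distrib[OF S A] mult_smult_assoc_mat[OF mult_carrier_mat[OF S A] T])
  have dims: "dim_row (S * A * T) = r" "dim_col (S * A * T) = s" for A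
    using d by auto
  have "A + B \<in> carrier_mat n n" "c \<cdot>\<^sub>m A \<in> carrier_mat n n"
    if "A \<in> carrier_mat n n" "B \<in> carrier_mat n n" for A B :: "real mat" and c
    using that by auto
  then show ?thesis
    unfolding linear_maps_def sketch_map_def d
    using div_mod_less_times[of _ r s]
    by (auto intro!: eq_vecI simp: add smult index_add_mat index_smult_mat dims simp del: index_mult_mat)
qed

lemma unflatten_sketch_map:
  assumes "S \<in> carrier_mat r n" "T \<in> carrier_mat n s" "A \<in> carrier_mat n n"
  shows "unflatten r s (sketch_map n S T A) = S * A * T"
proof (rule eq_matI)
  fix i j assume "i < dim_row (S * A * T)" "j < dim_col (S * A * T)"
  then have ij: "i < r" "j < s" using assms by auto
  have "i * s + j < r * s"
    using ij by (rule mult_add_less_times)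
  then show "unflatten r s (sketch_map n S T A) $$ (i, j) = (S * A * T) $$ (i, j)"
    using ij assms by (simp add: unflatten_def sketch_map_def)
qed (use assms in \<open>auto simp: unflatten_def\<close>)

section \<open>Measurability of the estimates\<close>

text \<open>For a finite exponent the norm is continuous; for the maximum norm the set is a finite
  union of open sets, one for each coordinate.\<close>

lemma open_less_lp_norm:
  fixes c :: "'a::topological_space \<Rightarrow> nat \<Rightarrow> real"
  assumes "1 \<le> p" "0 < k" "\<And>i. continuous_on UNIV (\<lambda>w. c w i)"
  shows "open {w. t < lp_norm p (vec k (c w))}"
proof (cases "p = \<infinity>")
  case True
  have "{w. t < lp_norm p (vec k (c w))} = (\<Union>i<k. {w. t < \<bar>c w i\<bar>})"
    unfolding lp_norm_def if_P[OF True] using assms(2)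
    by (subst Max_gr_iff) (auto simp: lessThan_empty_iff)
  also have "open \<dots>"
    by (intro open_UN ballI open_Collect_less continuous_intros assms)
  finally show ?thesis .
next
  case False
  then obtain P where P: "p = ereal P" "P \<ge> 1"
    using assms(1) by (cases p) (auto simp: one_ereal_def)
  have "continuous_on UNIV (\<lambda>w. lp_norm p (vec k (c w)))"
    unfolding P lp_norm_ereal dim_vec using P(2)
    by (intro continuous_on_powr' continuous_on_sum continuous_intros ballI conjI sum_nonneg)
       (auto intro!: continuous_on_powr' continuous_intros assms cong: continuous_on_cong)
  then show ?thesis by (intro open_Collect_less continuous_intros)
qed

text \<open>The operator norm is a supremum over uncountably many vectors, but it is lower semicontinuous
  in the entries.\<close>

lemma op_norm_measurable_entries:
  assumes "1 \<le> p" "1 \<le> q" "0 < r" "0 < s"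
  shows "(\<lambda>w :: nat \<Rightarrow> real. op_norm q p (mat r s (\<lambda>(i, j). w (i * s + j)))) \<in> borel_measurable borel"
proof (rule borel_measurableI_greater)
  fix t :: real
  have "{w \<in> space borel. t < op_norm q p (mat r s (\<lambda>(i, j). w (i * s + j)))} =
     (\<Union>x \<in> carrier_vec s - {0\<^sub>v s}. {w :: nat \<Rightarrow> real.
        t * lp_norm q x < lp_norm p (vec r (\<lambda>i. \<Sum>j<s. w (i * s + j) * x $ j))})"
  proof -
    have "mat r s (\<lambda>(i, j). w (i * s + j)) *\<^sub>v x = vec r (\<lambda>i. \<Sum>j<s. w (i * s + j) * x $ j)"
      if "x \<in> carrier_vec s" for w :: "nat \<Rightarrow> real" and x
      using that by (intro eq_vecI) (auto simp: scalar_prod_def atLeast0LessThan)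
    then show ?thesis
      by (auto simp: less_op_norm_iff[OF assms(1,2) mat_carrier assms(3,4)])
  qed
  also have "open \<dots>"
    by (intro open_UN ballI open_less_lp_norm assms continuous_intros) (auto intro!: continuous_intros)
  finally show "{w \<in> space borel. t < op_norm q p (mat r s (\<lambda>(i, j). w (i * s + j)))} \<in> sets borel"
    by simp
qed

lemma space_linear_maps_borel: "space (linear_maps_borel n d k) = linear_maps n d k"
  unfolding linear_maps_borel_def by (rule space_measure_of) auto

lemma measurable_linear_map_entry:
  assumes "A \<in> carrier_mat n d" "j < k"
  shows "(\<lambda>L. L A $ j) \<in> borel_measurable (linear_maps_borel n d k)"
proof (rule measurableI)
  fix U :: "real set" assume U: "U \<in> sets borel"
  have "(\<lambda>L. L A $ j) -` U \<inter> linear_maps n d k = {L \<in> linear_maps n d k. L A $ j \<in> U}" by auto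
  then show "(\<lambda>L. L A $ j) -` U \<inter> space (linear_maps_borel n d k) \<in> sets (linear_maps_borel n d k)"
    unfolding space_linear_maps_borel unfolding linear_maps_borel_def using assms U
    by (subst sets_measure_of) (auto intro!: sigma_sets.Basic)
qed simp

lemma measurable_op_norm_unflatten:
  assumes "1 \<le> p" "1 \<le> q" "0 < r" "0 < s" "A \<in> carrier_mat n d"
  shows "(\<lambda>L. op_norm q p (unflatten r s (L A))) \<in> borel_measurable (linear_maps_borel n d (r * s))"
proof -
  \<comment> \<open>Padding by 0 gives a function on all of \<open>nat\<close>, to which
    measurability in the product space applies. The row-major indices stay below
    \<open>r * s\<close>, so the padding is never read.\<close>
  define e where "e = (\<lambda>(L :: real mat \<Rightarrow> real vec) j. if j < r * s then L A $ j else 0)"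
  have "(\<lambda>L. e L j) \<in> borel_measurable (linear_maps_borel n d (r * s))" for j
    using measurable_linear_map_entry[OF assms(5), of j "r * s"] by (cases "j < r * s") (auto simp: e_def)
  then have "e \<in> borel_measurable (linear_maps_borel n d (r * s))"
    by (rule measurable_coordinatewise_then_product)
  from measurable_compose[OF this op_norm_measurable_entries[OF assms(1-4)]]
  have "(\<lambda>L. op_norm q p (mat r s (\<lambda>(i, j). e L (i * s + j)))) \<in> borel_measurable (linear_maps_borel n d (r * s))" .
  moreover have "mat r s (\<lambda>(i, j). e L (i * s + j)) = unflatten r s (L A)" for L
    by (intro eq_matI) (auto simp: e_def unflatten_def mult_add_less_times)
  ultimately show ?thesis by simp
qed

text \<open>The distribution is the image of the uniform measure on \<open>\<Omega>\<close>, which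
  turns the probability into a count of outcomes. Measurability of the estimate ensures that the
  event lies in the Borel sigma-algebra of the linear maps.\<close>

lemma sketching_familyI:
  fixes L :: "'w \<Rightarrow> real mat \<Rightarrow> real vec"
  assumes "finite \<Omega>" "\<Omega> \<noteq> {}" "\<And>\<omega>. \<omega> \<in> \<Omega> \<Longrightarrow> L \<omega> \<in> linear_maps n d k"
    and meas: "\<And>A. A \<in> carrier_mat n d \<Longrightarrow> (\<lambda>L. f (L A)) \<in> borel_measurable (linear_maps_borel n d k)"
    and card: "\<And>A. A \<in> carrier_mat n d \<Longrightarrow>
      5 / 6 * card \<Omega> \<le> card {\<omega> \<in> \<Omega>. f (L \<omega> A) \<in> approx_interval \<alpha> (op_norm q p A)}"
  shows "\<exists>S. sketching_family n d k \<alpha> q p S f"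
proof -
  let ?N = "linear_maps_borel n d k"
  define S where "S = distr (uniform_count_measure \<Omega>) ?N L"
  have L: "L \<in> measurable (uniform_count_measure \<Omega>) ?N"
    using assms(3) by (auto simp: measurable_def sets_uniform_count_measure space_uniform_count_measure space_linear_maps_borel)
  interpret prob_space "uniform_count_measure \<Omega>"
    using assms by (intro prob_space_uniform_count_measure)
  have "prob_space S" unfolding S_def by (rule prob_space_distr[OF L])
  moreover have "sets S = sets ?N" by (simp add: S_def)
  moreover have "measure S {L \<in> space S. f (L A) \<in> approx_interval \<alpha> (op_norm q p A)} \<ge> 5 / 6"
    if A: "A \<in> carrier_mat n d" for A
  proof -
    let ?I = "approx_interval \<alpha> (op_norm q p A)"
    have "?I \<in> sets borel" by (simp add: approx_interval_def)
    moreover have "{L \<in> space ?N. f (L A) \<in> ?I} = (\<lambda>L. f (L A)) -` ?I \<inter> space ?N" by auto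
    ultimately have "{L \<in> space ?N. f (L A) \<in> ?I} \<in> sets ?N"
      using measurable_sets[OF meas[OF A]] by simp
    then have "measure S {L \<in> space S. f (L A) \<in> ?I} =
        measure (uniform_count_measure \<Omega>) (L -` {L \<in> space ?N. f (L A) \<in> ?I} \<inter> \<Omega>)"
      unfolding S_def using L by (simp add: measure_distr space_uniform_count_measure)
    also have "L -` {L \<in> space ?N. f (L A) \<in> ?I} \<inter> \<Omega> = {\<omega> \<in> \<Omega>. f (L \<omega> A) \<in> ?I}"
      using assms(3) by (auto simp: space_linear_maps_borel)
    also have "measure (uniform_count_measure \<Omega>) \<dots> = card {\<omega> \<in> \<Omega>. f (L \<omega> A) \<in> ?I} / card \<Omega>"
      using assms(1) by (intro measure_uniform_count_measure) auto
    also have "\<dots> \<ge> 5 / 6"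
      using card[OF A] assms(1,2) by (simp add: le_divide_eq card_gt_0_iff)
    finally show ?thesis .
  qed
  ultimately show ?thesis unfolding sketching_family_def by blast
qed

section \<open>Block sums\<close>

text \<open>This is the power mean inequality, obtained from Jensen's inequality with equal weights.
  Zero terms contribute to neither side, so the convexity of the power is applied to the positive
  ones only.\<close>

lemma sum_powr_le:
  fixes t :: "'a \<Rightarrow> real"
  assumes "finite I" "card I \<le> m" "1 \<le> P" "\<And>i. i \<in> I \<Longrightarrow> 0 \<le> t i"
  shows "(\<Sum>i\<in>I. t i) powr P \<le> real m powr (P - 1) * (\<Sum>i\<in>I. t i powr P)"
proof -
  define J where "J = {i \<in> I. 0 < t i}"
  have J: "finite J" "card J \<le> m" "J \<subseteq> I"
    using assms(1,2) card_mono[of I J] by (auto simp: J_def)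
  have eq: "(\<Sum>i\<in>I. t i) = (\<Sum>i\<in>J. t i)" "(\<Sum>i\<in>I. t i powr P) = (\<Sum>i\<in>J. t i powr P)"
    using assms(1,4) by (force simp: J_def intro: sum.mono_neutral_right)+
  show ?thesis
  proof (cases "J = {}")
    case True
    then show ?thesis unfolding eq using assms(3) by simp
  next
    case False
    define c where "c = real (card J)"
    have c: "0 < c" "c \<le> real m" using J False by (auto simp: c_def card_gt_0_iff)
    have "(\<Sum>i\<in>J. (1 / c) *\<^sub>R t i) powr P \<le> (\<Sum>i\<in>J. (1 / c) * t i powr P)"
      using J(1) False c by (intro convex_on_sum[OF _ _ powr_convex[OF assms(3)]]) (auto simp: c_def J_def)
    then have "((1 / c) * (\<Sum>i\<in>J. t i)) powr P \<le> (1 / c) * (\<Sum>i\<in>J. t i powr P)"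
      by (simp add: sum_distrib_left)
    moreover have "0 \<le> (\<Sum>i\<in>J. t i)" by (auto simp: J_def intro: sum_nonneg)
    ultimately have "(1 / c) powr P * (\<Sum>i\<in>J. t i) powr P \<le> (1 / c) * (\<Sum>i\<in>J. t i powr P)"
      using c by (subst (asm) powr_mult) auto
    then have "c powr P * ((1 / c) powr P * (\<Sum>i\<in>J. t i) powr P) \<le> c powr P * ((1 / c) * (\<Sum>i\<in>J. t i powr P))"
      by (rule mult_left_mono) simp
    moreover have "c powr P * (1 / c) powr P = 1" using c by (simp flip: powr_mult)
    ultimately have "(\<Sum>i\<in>J. t i) powr P \<le> c powr (P - 1) * (\<Sum>i\<in>J. t i powr P)"
      using c by (simp add: powr_diff mult.assoc[symmetric])
    also have "\<dots> \<le> real m powr (P - 1) * (\<Sum>i\<in>J. t i powr P)"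
      using c assms(3) by (intro mult_right_mono powr_mono2 sum_nonneg) auto
    finally show ?thesis unfolding eq .
  qed
qed

lemma lp_norm_le_of_powr_sum_le:
  assumes "1 \<le> P" "0 \<le> c"
    "(\<Sum>i<dim_vec x. \<bar>x $ i\<bar> powr P) \<le> c powr P * (\<Sum>i<dim_vec y. \<bar>y $ i\<bar> powr P)"
  shows "lp_norm (ereal P) x \<le> c * lp_norm (ereal P) y"
proof -
  have "lp_norm (ereal P) x \<le> (c powr P * (\<Sum>i<dim_vec y. \<bar>y $ i\<bar> powr P)) powr (1 / P)"
    unfolding lp_norm_ereal using assms by (intro powr_mono2) (auto intro: sum_nonneg)
  also have "\<dots> = c * lp_norm (ereal P) y"
    unfolding lp_norm_ereal using assms by (simp add: powr_mult powr_powr sum_nonneg)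
  finally show ?thesis .
qed

section \<open>Blocks of consecutive indices and their matrices\<close>

text \<open>For positive \<open>n\<close> and \<open>m\<close> this is n / m rounded up. It is
  positive in all cases, so that sketched matrices are never empty.\<close>

definition nblocks :: "nat \<Rightarrow> nat \<Rightarrow> nat" where
  "nblocks n m = (n - 1) div m + 1"

definition block :: "nat \<Rightarrow> nat \<Rightarrow> nat \<Rightarrow> nat set" where
  "block n m r = {i \<in> {..<n}. i div m = r}"

lemma div_less_nblocks: "i < n \<Longrightarrow> i div m < nblocks n m"
  unfolding nblocks_def by (metis Suc_eq_plus1 Suc_pred' div_le_mono gr_zeroI less_Suc_eq_le not_less0)

lemma nblocks_pos: "0 < nblocks n m"
  by (simp add: nblocks_def)

lemma finite_block: "finite (block n m r)"
  by (simp add: block_def)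

lemma card_block_le:
  assumes "0 < m"
  shows "card (block n m r) \<le> m"
proof -
  have "block n m r \<subseteq> {r * m..<r * m + m}"
    using dividend_less_div_times[OF assms] by (auto simp: block_def add.commute)
  then have "card (block n m r) \<le> card {r * m..<r * m + m}" by (intro card_mono) auto
  then show ?thesis by simp
qed

lemma sum_blocks: "(\<Sum>r<nblocks n m. \<Sum>i\<in>block n m r. F i) = (\<Sum>i<n. F i)"
  unfolding block_def by (intro sum.group) (auto intro: div_less_nblocks)

lemma sum_div_le:
  fixes F :: "nat \<Rightarrow> real"
  assumes "0 < m" "\<And>r. 0 \<le> F r"
  shows "(\<Sum>i<n. F (i div m)) \<le> real m * (\<Sum>r<nblocks n m. F r)"
proof -
  have "(\<Sum>i<n. F (i div m)) = (\<Sum>r<nblocks n m. \<Sum>i\<in>block n m r. F (i div m))"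
    by (rule sum_blocks[symmetric])
  also have "\<dots> = (\<Sum>r<nblocks n m. real (card (block n m r)) * F r)"
    by (auto simp: block_def)
  also have "\<dots> \<le> (\<Sum>r<nblocks n m. real m * F r)"
    using assms card_block_le by (intro sum_mono mult_right_mono) auto
  finally show ?thesis by (simp add: sum_distrib_left)
qed

text \<open>Both factors of the sketch have this origin: on the left of \<open>A\<close> the matrix
  forms weighted sums over blocks of rows, and its transpose on the right does the same for
  columns.\<close>

definition block_mat :: "nat \<Rightarrow> nat \<Rightarrow> (nat \<Rightarrow> real) \<Rightarrow> real mat" where
  "block_mat n m g = mat (nblocks n m) n (\<lambda>(r, i). if i div m = r then g i else 0)"

lemma block_mat_carrier [simp]: "block_mat n m g \<in> carrier_mat (nblocks n m) n"
  by (simp add: block_mat_def)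

lemma block_mat_dim [simp]: "dim_row (block_mat n m g) = nblocks n m" "dim_col (block_mat n m g) = n"
  by (simp_all add: block_mat_def)

lemma block_mat_mult_index:
  assumes "r < nblocks n m" "y \<in> carrier_vec n"
  shows "(block_mat n m g *\<^sub>v y) $ r = (\<Sum>i\<in>block n m r. g i * y $ i)"
proof -
  have "(block_mat n m g *\<^sub>v y) $ r = (\<Sum>i<n. (if i div m = r then g i else 0) * y $ i)"
    using assms by (auto simp: block_mat_def scalar_prod_def atLeast0LessThan intro!: sum.cong)
  also have "\<dots> = (\<Sum>i<n. if i div m = r then g i * y $ i else 0)"
    by (intro sum.cong) auto
  also have "\<dots> = (\<Sum>i\<in>block n m r. g i * y $ i)"
    unfolding block_def by (rule sum.inter_filter[symmetric]) simp
  finally show ?thesis .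
qed

lemma transpose_block_mat_mult_index:
  assumes "i < n" "z \<in> carrier_vec (nblocks n m)"
  shows "(transpose_mat (block_mat n m g) *\<^sub>v z) $ i = g i * z $ (i div m)"
proof -
  have "(transpose_mat (block_mat n m g) *\<^sub>v z) $ i
      = (\<Sum>r<nblocks n m. (if i div m = r then g i else 0) * z $ r)"
    using assms by (auto simp: block_mat_def scalar_prod_def atLeast0LessThan intro!: sum.cong)
  also have "\<dots> = (\<Sum>r<nblocks n m. if i div m = r then g i * z $ r else 0)"
    by (intro sum.cong) auto
  also have "\<dots> = g i * z $ (i div m)"
    using div_less_nblocks[OF assms(1)] by simp
  finally show ?thesis .
qed

text \<open>The power mean inequality in each block gives the exponent of \<open>m\<close>. The
  vector \<open>z\<close> is only assumed to be dominated by block sums, which covers random block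
  sums as well as the test vector in \<open>lp_norm_row_mult_le\<close>.\<close>

lemma lp_norm_block_sums_le:
  assumes "1 \<le> P" "0 < m" "0 \<le> M" "x \<in> carrier_vec n" "z \<in> carrier_vec (nblocks n m)"
    "\<And>r. r < nblocks n m \<Longrightarrow> \<bar>z $ r\<bar> \<le> M * (\<Sum>i\<in>block n m r. \<bar>x $ i\<bar>)"
  shows "lp_norm (ereal P) z \<le> M * real m powr (1 - 1 / P) * lp_norm (ereal P) x"
proof (rule lp_norm_le_of_powr_sum_le[OF assms(1)])
  have "\<bar>z $ r\<bar> powr P \<le> M powr P * real m powr (P - 1) * (\<Sum>i\<in>block n m r. \<bar>x $ i\<bar> powr P)"
    if "r < nblocks n m" for r
  proof -
    have "\<bar>z $ r\<bar> powr P \<le> (M * (\<Sum>i\<in>block n m r. \<bar>x $ i\<bar>)) powr P"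
      using assms that by (intro powr_mono2) auto
    also have "\<dots> = M powr P * (\<Sum>i\<in>block n m r. \<bar>x $ i\<bar>) powr P"
      by (rule powr_mult)
    also have "\<dots> \<le> M powr P * (real m powr (P - 1) * (\<Sum>i\<in>block n m r. \<bar>x $ i\<bar> powr P))"
      using assms finite_block card_block_le by (intro mult_left_mono sum_powr_le) auto
    finally show ?thesis by (simp add: mult.assoc)
  qed
  then have "(\<Sum>r<nblocks n m. \<bar>z $ r\<bar> powr P)
      \<le> (\<Sum>r<nblocks n m. M powr P * real m powr (P - 1) * (\<Sum>i\<in>block n m r. \<bar>x $ i\<bar> powr P))"
    by (intro sum_mono) simp
  also have "\<dots> = M powr P * real m powr (P - 1) * (\<Sum>i<n. \<bar>x $ i\<bar> powr P)"
    by (simp add: sum_blocks flip: sum_distrib_left)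
  also have "M powr P * real m powr (P - 1) = (M * real m powr (1 - 1 / P)) powr P"
    using assms by (simp add: powr_mult powr_powr algebra_simps)
  finally show "(\<Sum>i<dim_vec z. \<bar>z $ i\<bar> powr P)
      \<le> (M * real m powr (1 - 1 / P)) powr P * (\<Sum>i<dim_vec x. \<bar>x $ i\<bar> powr P)"
    using assms(4,5) by simp
qed (use assms in simp)

lemma lp_norm_block_mat_le:
  assumes "1 \<le> P" "0 < m" "0 \<le> M" "\<And>i. i < n \<Longrightarrow> \<bar>g i\<bar> \<le> M" "y \<in> carrier_vec n"
  shows "lp_norm (ereal P) (block_mat n m g *\<^sub>v y) \<le> M * real m powr (1 - 1 / P) * lp_norm (ereal P) y"
proof (rule lp_norm_block_sums_le[OF assms(1-3,5)])
  show "block_mat n m g *\<^sub>v y \<in> carrier_vec (nblocks n m)"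
    using block_mat_carrier assms(5) by (rule mult_mat_vec_carrier)
  fix r assume "r < nblocks n m"
  then have "\<bar>(block_mat n m g *\<^sub>v y) $ r\<bar> \<le> (\<Sum>i\<in>block n m r. \<bar>g i * y $ i\<bar>)"
    using assms by (simp add: block_mat_mult_index del: index_mult_mat_vec)
  also have "\<dots> \<le> (\<Sum>i\<in>block n m r. M * \<bar>y $ i\<bar>)"
    using assms by (intro sum_mono) (auto simp: abs_mult block_def intro!: mult_right_mono)
  finally show "\<bar>(block_mat n m g *\<^sub>v y) $ r\<bar> \<le> M * (\<Sum>i\<in>block n m r. \<bar>y $ i\<bar>)"
    by (simp add: sum_distrib_left)
qed

text \<open>Each entry of \<open>z\<close> is copied to at most \<open>b\<close> places, with
  weights at most \<open>M\<close>, hence the factor \<open>b powr (1 / Q)\<close>.\<close>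

lemma lp_norm_transpose_block_mat_le:
  assumes "1 \<le> Q" "0 < b" "0 \<le> M" "\<And>i. i < n \<Longrightarrow> \<bar>h i\<bar> \<le> M" "z \<in> carrier_vec (nblocks n b)"
  shows "lp_norm (ereal Q) (transpose_mat (block_mat n b h) *\<^sub>v z) \<le> M * real b powr (1 / Q) * lp_norm (ereal Q) z"
proof (rule lp_norm_le_of_powr_sum_le[OF assms(1)])
  have "(\<Sum>i<n. \<bar>(transpose_mat (block_mat n b h) *\<^sub>v z) $ i\<bar> powr Q) = (\<Sum>i<n. \<bar>h i * z $ (i div b)\<bar> powr Q)"
    using transpose_block_mat_mult_index[OF _ assms(5)] by (intro sum.cong) auto
  also have "\<dots> \<le> (\<Sum>i<n. M powr Q * \<bar>z $ (i div b)\<bar> powr Q)"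
    using assms by (intro sum_mono) (auto simp: abs_mult powr_mult intro!: mult_right_mono powr_mono2)
  also have "\<dots> = M powr Q * (\<Sum>i<n. \<bar>z $ (i div b)\<bar> powr Q)" by (simp add: sum_distrib_left)
  also have "\<dots> \<le> M powr Q * (real b * (\<Sum>r<nblocks n b. \<bar>z $ r\<bar> powr Q))"
    using assms by (intro mult_left_mono sum_div_le[of b "\<lambda>r. \<bar>z $ r\<bar> powr Q"]) auto
  also have "\<dots> = (M * real b powr (1 / Q)) powr Q * (\<Sum>r<nblocks n b. \<bar>z $ r\<bar> powr Q)"
    using assms by (simp add: powr_mult powr_powr)
  finally show "(\<Sum>i<dim_vec (transpose_mat (block_mat n b h) *\<^sub>v z). \<bar>(transpose_mat (block_mat n b h) *\<^sub>v z) $ i\<bar> powr Q)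
      \<le> (M * real b powr (1 / Q)) powr Q * (\<Sum>i<dim_vec z. \<bar>z $ i\<bar> powr Q)"
    using assms by simp
qed (use assms in auto)

section \<open>Lower bounds from the coordinates that are not cancelled\<close>

text \<open>The threshold 1/2 is chosen such that two block sums below it differ by less than the
  absolute value of \<open>y\<close> at \<open>i\<close>. By strictness a zero coordinate never
  counts as cancelled.\<close>

definition cancelled :: "nat \<Rightarrow> nat \<Rightarrow> (nat \<Rightarrow> real) \<Rightarrow> real vec \<Rightarrow> nat set" where
  "cancelled n m g y = {i \<in> {..<n}. \<bar>(block_mat n m g *\<^sub>v y) $ (i div m)\<bar> < \<bar>y $ i\<bar> / 2}"

text \<open>The weights are arbitrary because powers of the entries of \<open>y\<close> are used for
  the rows and products of entries of two vectors for the columns.\<close>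

lemma sum_not_cancelled_ge:
  fixes u :: "nat \<Rightarrow> real"
  assumes "2 * (\<Sum>i\<in>cancelled n m g y. u i) \<le> (\<Sum>i<n. u i)"
  shows "(\<Sum>i<n. u i) \<le> 2 * (\<Sum>i\<in>{..<n} - cancelled n m g y. u i)"
proof -
  have "(\<Sum>i<n. u i) = (\<Sum>i\<in>{..<n} - cancelled n m g y. u i) + (\<Sum>i\<in>cancelled n m g y. u i)"
    by (rule sum.subset_diff) (auto simp: cancelled_def)
  then show ?thesis using assms by linarith
qed

text \<open>A coordinate that is not cancelled is at most twice its block sum, and each block sum is
  charged by at most \<open>m\<close> coordinates.\<close>

lemma lp_norm_le_block_mat:
  assumes P: "1 \<le> P" and "0 < m" "y \<in> carrier_vec n"
    and "2 * (\<Sum>i\<in>cancelled n m g y. \<bar>y $ i\<bar> powr P) \<le> (\<Sum>i<n. \<bar>y $ i\<bar> powr P)"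
  shows "lp_norm (ereal P) y \<le> 4 * real m powr (1 / P) * lp_norm (ereal P) (block_mat n m g *\<^sub>v y)"
proof (rule lp_norm_le_of_powr_sum_le[OF P])
  let ?w = "block_mat n m g *\<^sub>v y"
  have "(\<Sum>i<n. \<bar>y $ i\<bar> powr P) \<le> 2 * (\<Sum>i\<in>{..<n} - cancelled n m g y. \<bar>y $ i\<bar> powr P)"
    by (rule sum_not_cancelled_ge[OF assms(4)])
  also have "\<dots> \<le> 2 * (\<Sum>i\<in>{..<n} - cancelled n m g y. (2 * \<bar>?w $ (i div m)\<bar>) powr P)"
    using P by (intro mult_left_mono sum_mono powr_mono2) (auto simp: cancelled_def)
  also have "\<dots> \<le> 2 * (\<Sum>i<n. (2 * \<bar>?w $ (i div m)\<bar>) powr P)"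
    by (intro mult_left_mono sum_mono2) auto
  also have "\<dots> \<le> 2 * (real m * (\<Sum>r<nblocks n m. (2 * \<bar>?w $ r\<bar>) powr P))"
    by (intro mult_left_mono sum_div_le[of m "\<lambda>r. (2 * \<bar>?w $ r\<bar>) powr P"] assms) auto
  also have "\<dots> = 2 * 2 powr P * real m * (\<Sum>r<nblocks n m. \<bar>?w $ r\<bar> powr P)"
    by (simp add: powr_mult mult_ac flip: sum_distrib_left)
  \<comment> \<open>The factor 2 for the discarded mass is absorbed by a second
    \<open>2 powr P\<close>, so that the root yields a constant independent of
    \<open>P\<close>.\<close>
  also have "\<dots> \<le> 4 powr P * real m * (\<Sum>r<nblocks n m. \<bar>?w $ r\<bar> powr P)"
  proof (intro mult_right_mono sum_nonneg)
    have "(2::real) powr 1 \<le> 2 powr P" using P by (intro powr_mono) auto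
    then have "2 * 2 powr P \<le> 2 powr P * 2 powr P" by simp
    also have "\<dots> = 4 powr P" by (simp flip: powr_mult)
    finally show "2 * 2 powr P \<le> 4 powr P" .
  qed auto
  also have "4 powr P * real m = (4 * real m powr (1 / P)) powr P"
    using P by (simp add: powr_mult powr_powr)
  finally show "(\<Sum>i<dim_vec y. \<bar>y $ i\<bar> powr P) \<le> (4 * real m powr (1 / P)) powr P * (\<Sum>i<dim_vec ?w. \<bar>?w $ i\<bar> powr P)"
    using assms by simp
qed simp

text \<open>The product of \<open>B\<close> with the transposed block matrix is a row of block sums
  \<open>w\<close>. A test vector with the signs of \<open>w\<close> and the l1 masses of
  \<open>x\<close> on the blocks prevents any cancellation between blocks, and \<open>w\<close>
  dominates half of each entry of \<open>B\<close> that is not cancelled.\<close>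

lemma lp_norm_row_mult_le:
  fixes B :: "real mat"
  assumes "1 \<le> p" "1 \<le> Q" "0 < b" "0 < n" "B \<in> carrier_mat 1 n" "x \<in> carrier_vec n"
    and "2 * (\<Sum>j\<in>cancelled n b h (row B 0). \<bar>row B 0 $ j * x $ j\<bar>) \<le> (\<Sum>j<n. \<bar>row B 0 $ j * x $ j\<bar>)"
  shows "lp_norm p (B *\<^sub>v x) \<le>
    4 * real b powr (1 - 1 / Q) * op_norm (ereal Q) p (B * transpose_mat (block_mat n b h)) * lp_norm (ereal Q) x"
proof -
  let ?v = "row B 0" and ?T = "transpose_mat (block_mat n b h)" and ?k = "nblocks n b"
  have Q: "1 \<le> ereal Q" using assms by (simp add: one_ereal_def)
  have v: "?v \<in> carrier_vec n" using assms by auto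
  have T: "?T \<in> carrier_mat n ?k" using block_mat_carrier transpose_carrier_mat by blast
  define w where "w = block_mat n b h *\<^sub>v ?v"
  define z where "z = vec ?k (\<lambda>r. sgn (w $ r) * (\<Sum>j\<in>block n b r. \<bar>x $ j\<bar>))"
  have z: "z \<in> carrier_vec ?k" by (simp add: z_def)
  have "(B *\<^sub>v (?T *\<^sub>v z)) $ 0 = (\<Sum>j<n. ?v $ j * (?T *\<^sub>v z) $ j)"
    using assms by (auto simp: scalar_prod_def atLeast0LessThan simp del: index_row)
  also have "\<dots> = (\<Sum>j<n. ?v $ j * (h j * z $ (j div b)))"
    by (intro sum.cong refl) (simp add: transpose_block_mat_mult_index[OF _ z] del: index_mult_mat_vec)
  also have "\<dots> = (\<Sum>r<?k. \<Sum>j\<in>block n b r. ?v $ j * (h j * z $ (j div b)))"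
    by (rule sum_blocks[symmetric])
  also have "\<dots> = (\<Sum>r<?k. w $ r * z $ r)"
  proof (rule sum.cong[OF refl])
    fix r assume "r \<in> {..<?k}"
    then have wr: "w $ r = (\<Sum>j\<in>block n b r. h j * ?v $ j)"
      unfolding w_def by (intro block_mat_mult_index[OF _ v]) simp
    show "(\<Sum>j\<in>block n b r. ?v $ j * (h j * z $ (j div b))) = w $ r * z $ r"
      unfolding wr sum_distrib_right by (auto simp: block_def intro!: sum.cong)
  qed
  also have "\<dots> = (\<Sum>r<?k. \<Sum>j\<in>block n b r. \<bar>w $ (j div b)\<bar> * \<bar>x $ j\<bar>)"
  proof (rule sum.cong[OF refl])
    fix r assume "r \<in> {..<?k}"
    then have "w $ r * z $ r = \<bar>w $ r\<bar> * (\<Sum>j\<in>block n b r. \<bar>x $ j\<bar>)"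
      by (simp add: z_def abs_sgn)
    then show "w $ r * z $ r = (\<Sum>j\<in>block n b r. \<bar>w $ (j div b)\<bar> * \<bar>x $ j\<bar>)"
      unfolding sum_distrib_left by (auto simp: block_def intro!: sum.cong)
  qed
  also have "\<dots> = (\<Sum>j<n. \<bar>w $ (j div b)\<bar> * \<bar>x $ j\<bar>)" by (rule sum_blocks)
  finally have BTz: "(B *\<^sub>v (?T *\<^sub>v z)) $ 0 = (\<Sum>j<n. \<bar>w $ (j div b)\<bar> * \<bar>x $ j\<bar>)" .
  have "\<bar>(B *\<^sub>v x) $ 0\<bar> = \<bar>\<Sum>j<n. ?v $ j * x $ j\<bar>"
    using assms by (auto simp: scalar_prod_def atLeast0LessThan simp del: index_row)
  also have "\<dots> \<le> (\<Sum>j<n. \<bar>?v $ j * x $ j\<bar>)" by (rule sum_abs)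
  also have "\<dots> \<le> 2 * (\<Sum>j\<in>{..<n} - cancelled n b h ?v. \<bar>?v $ j * x $ j\<bar>)"
    by (rule sum_not_cancelled_ge[OF assms(7)])
  also have "\<dots> \<le> 2 * (\<Sum>j\<in>{..<n} - cancelled n b h ?v. 2 * \<bar>w $ (j div b)\<bar> * \<bar>x $ j\<bar>)"
    by (intro mult_left_mono sum_mono) (auto simp: cancelled_def w_def abs_mult intro!: mult_right_mono)
  also have "\<dots> \<le> 2 * (\<Sum>j<n. 2 * \<bar>w $ (j div b)\<bar> * \<bar>x $ j\<bar>)"
    by (intro mult_left_mono sum_mono2) auto
  also have "\<dots> = 4 * (B *\<^sub>v (?T *\<^sub>v z)) $ 0"
    unfolding BTz by (simp add: sum_distrib_left mult_ac)
  also have "\<dots> \<le> 4 * lp_norm p ((B * ?T) *\<^sub>v z)"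
    using abs_index_le_lp_norm[OF assms(1), of 0 "B *\<^sub>v (?T *\<^sub>v z)"] assms(5)
    by (simp add: assoc_mult_mat_vec[OF assms(5) T z] del: index_mult_mat_vec)
  also have "\<dots> \<le> 4 * (op_norm (ereal Q) p (B * ?T) * lp_norm (ereal Q) z)"
    using lp_norm_mult_le_op_norm[OF assms(1) Q mult_carrier_mat[OF assms(5) T] _ nblocks_pos z] by simp
  also have "\<dots> \<le> 4 * (op_norm (ereal Q) p (B * ?T) * (1 * real b powr (1 - 1 / Q) * lp_norm (ereal Q) x))"
  proof (intro mult_left_mono)
    \<comment> \<open>Signs are bounded by 1, so the bound for block sums applies with
      \<open>M = 1\<close>.\<close>
    show "lp_norm (ereal Q) z \<le> 1 * real b powr (1 - 1 / Q) * lp_norm (ereal Q) x"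
      using assms z
      by (intro lp_norm_block_sums_le)
         (auto simp: z_def abs_mult sum_nonneg abs_sgn_eq)
    show "0 \<le> op_norm (ereal Q) p (B * ?T)"
      by (rule op_norm_nonneg[OF assms(1) Q mult_carrier_mat[OF assms(5) T] _ nblocks_pos]) simp
  qed simp
  finally have *: "\<bar>(B *\<^sub>v x) $ 0\<bar> \<le> 4 * (op_norm (ereal Q) p (B * ?T) * (1 * real b powr (1 - 1 / Q) * lp_norm (ereal Q) x))" .
  \<comment> \<open>The vector has dimension 1, so its norm is at most the absolute value of its
    only entry, whatever \<open>p\<close> is.\<close>
  have "lp_norm p (B *\<^sub>v x) \<le> real (dim_vec (B *\<^sub>v x)) * \<bar>(B *\<^sub>v x) $ 0\<bar>"
    using assms(1,5) by (intro lp_norm_le_of_bound) (auto simp del: index_mult_mat_vec)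
  also have "\<dots> = \<bar>(B *\<^sub>v x) $ 0\<bar>" using assms(5) by simp
  finally show ?thesis using * by (simp add: mult_ac)
qed

section \<open>Random coefficients\<close>

text \<open>Probabilities are proportions of this finite set. Distinct coefficients, being natural
  numbers, differ by at least 1.\<close>

definition coeff_space :: "nat \<Rightarrow> nat \<Rightarrow> (nat \<Rightarrow> nat) set" where
  "coeff_space n M = ({..<n} \<rightarrow>\<^sub>E {..<M})"

lemma finite_coeff_space: "finite (coeff_space n M)"
  by (auto simp: coeff_space_def intro!: finite_PiE)

lemma card_coeff_space: "card (coeff_space n M) = M ^ n"
  by (simp add: coeff_space_def card_PiE)

text \<open>If all coefficients but the one at i are kept fixed, the possible values of the block sum are
  spaced by the absolute value of y at i, so at most one of them is below half of it.\<close>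

lemma card_coeff_space_cancelled:
  assumes i: "i < n" and y: "y \<in> carrier_vec n"
  shows "M * card {g \<in> coeff_space n M. i \<in> cancelled n m (\<lambda>i. real (g i)) y} \<le> M ^ n"
proof -
  let ?bad = "{g \<in> coeff_space n M. i \<in> cancelled n m (\<lambda>i. real (g i)) y}"
  have "inj_on (\<lambda>g. restrict g ({..<n} - {i})) ?bad"
  proof (rule inj_onI)
    fix g h assume g: "g \<in> ?bad" and h: "h \<in> ?bad"
      and eq: "restrict g ({..<n} - {i}) = restrict h ({..<n} - {i})"
    have gh: "g j = h j" if "j < n" "j \<noteq> i" for j
      using fun_cong[OF eq, of j] that by simp
    let ?w = "\<lambda>g. \<Sum>j\<in>block n m (i div m). real (g j) * y $ j"
    have bad: "\<bar>?w g\<bar> < \<bar>y $ i\<bar> / 2" if "g \<in> ?bad" for g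
      using that block_mat_mult_index[OF div_less_nblocks[OF i] y] by (simp add: cancelled_def)
    have "?w g - ?w h = (\<Sum>j\<in>block n m (i div m). (real (g j) - real (h j)) * y $ j)"
      by (simp add: sum_subtractf left_diff_distrib)
    also have "\<dots> = (\<Sum>j\<in>{i}. (real (g j) - real (h j)) * y $ j)"
      using gh i finite_block by (intro sum.mono_neutral_right) (auto simp: block_def)
    finally have "\<bar>(real (g i) - real (h i)) * y $ i\<bar> < 1 * \<bar>y $ i\<bar>"
      using bad[OF g] bad[OF h] by simp
    then have "\<bar>real (g i) - real (h i)\<bar> < 1"
      unfolding abs_mult by (rule mult_right_less_imp_less) (rule abs_ge_zero)
    then have "g i = h i" by linarith
    show "g = h"
    proof (rule PiE_ext)
      show "g \<in> {..<n} \<rightarrow>\<^sub>E {..<M}" "h \<in> {..<n} \<rightarrow>\<^sub>E {..<M}"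
        using g h by (auto simp: coeff_space_def)
    qed (use gh \<open>g i = h i\<close> in blast)
  qed
  moreover have "(\<lambda>g. restrict g ({..<n} - {i})) ` ?bad \<subseteq> ({..<n} - {i}) \<rightarrow>\<^sub>E {..<M}"
  proof (rule image_subsetI)
    fix g assume "g \<in> ?bad"
    then have "g \<in> {..<n} \<rightarrow>\<^sub>E {..<M}" by (simp add: coeff_space_def)
    then show "restrict g ({..<n} - {i}) \<in> ({..<n} - {i}) \<rightarrow>\<^sub>E {..<M}"
      unfolding restrict_PiE_iff by blast
  qed
  ultimately have "card ?bad \<le> card (({..<n} - {i}) \<rightarrow>\<^sub>E {..<M})"
    by (rule card_inj_on_le) (auto intro: finite_PiE)
  also have "\<dots> = M ^ (n - 1)" using i by (simp add: card_PiE)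
  finally have "M * card ?bad \<le> M * M ^ (n - 1)" by simp
  also have "\<dots> = M ^ n" using i by (simp flip: power_Suc)
  finally show ?thesis .
qed

text \<open>This is Markov's inequality by double counting. Each index is cancelled for at most a
  proportion 1/M of all \<open>g\<close>, so the cancelled weight is on average at most 1/M of the
  total and exceeds half of it for a proportion of at most 2/M.\<close>

lemma card_coeff_space_heavily_cancelled:
  fixes u :: "nat \<Rightarrow> real"
  assumes y: "y \<in> carrier_vec n" and u: "\<And>i. 0 \<le> u i"
  shows "M * card {g \<in> coeff_space n M. (\<Sum>i<n. u i) < 2 * (\<Sum>i\<in>cancelled n m (\<lambda>i. real (g i)) y. u i)}
    \<le> 2 * M ^ n"
proof -
  let ?C = "\<lambda>g :: nat \<Rightarrow> nat. cancelled n m (\<lambda>i. real (g i)) y"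
  let ?bad = "{g \<in> coeff_space n M. (\<Sum>i<n. u i) < 2 * (\<Sum>i\<in>?C g. u i)}"
  let ?U = "\<Sum>i<n. u i"
  have fin: "finite ?bad" using finite_coeff_space by simp
  have C: "?C g = {i \<in> {..<n}. i \<in> ?C g}" for g by (auto simp: cancelled_def)
  show ?thesis
  proof (cases "?U = 0")
    \<comment> \<open>Markov's inequality divides by the total weight. If that is 0, the strict
      inequality in \<open>?bad\<close> fails for every \<open>g\<close>.\<close>
    case True
    have "(\<Sum>i\<in>?C g. u i) \<le> ?U" for g
      using u by (intro sum_mono2) (auto simp: cancelled_def)
    then have "?bad = {}" unfolding True by (auto simp: not_less)
    then show ?thesis by (simp only: card.empty)
  next
    case False
    then have U: "0 < ?U" using u by (simp add: less_le sum_nonneg)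
    have "real (card ?bad) * ?U \<le> (\<Sum>g\<in>?bad. 2 * (\<Sum>i\<in>?C g. u i))"
      by (intro sum_bounded_below) auto
    also have "\<dots> \<le> (\<Sum>g\<in>coeff_space n M. 2 * (\<Sum>i\<in>?C g. u i))"
      using u finite_coeff_space by (intro sum_mono2) (auto intro: sum_nonneg)
    also have "\<dots> = 2 * (\<Sum>g\<in>coeff_space n M. \<Sum>i<n. if i \<in> ?C g then u i else 0)"
      by (subst C) (simp only: sum.inter_filter finite_lessThan sum_distrib_left)
    also have "\<dots> = 2 * (\<Sum>i<n. \<Sum>g\<in>coeff_space n M. if i \<in> ?C g then u i else 0)"
      by (subst sum.swap) simp
    also have "\<dots> = 2 * (\<Sum>i<n. real (card {g \<in> coeff_space n M. i \<in> ?C g}) * u i)"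
      using finite_coeff_space by (simp flip: sum.inter_filter)
    finally have "real M * (real (card ?bad) * ?U)
        \<le> real M * (2 * (\<Sum>i<n. real (card {g \<in> coeff_space n M. i \<in> ?C g}) * u i))"
      by (rule mult_left_mono) simp
    also have "\<dots> = 2 * (\<Sum>i<n. real (M * card {g \<in> coeff_space n M. i \<in> ?C g}) * u i)"
      by (simp add: sum_distrib_left mult_ac)
    also have "\<dots> \<le> 2 * (\<Sum>i<n. real (M ^ n) * u i)"
      using card_coeff_space_cancelled[OF _ y] u
      by (intro mult_left_mono sum_mono mult_right_mono of_nat_mono) auto
    also have "\<dots> = real (2 * M ^ n) * ?U" by (simp flip: sum_distrib_left)
    finally have "real (M * card ?bad) * ?U \<le> real (2 * M ^ n) * ?U" by (simp add: mult_ac)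
    then have "real (M * card ?bad) \<le> real (2 * M ^ n)" using U by (rule mult_right_le_imp_le)
    then show ?thesis by (simp only: of_nat_le_iff)
  qed
qed

section \<open>Operator norms under random compression\<close>

text \<open>One nearly optimal \<open>x\<close>, fixed before the coefficients are drawn, witnesses
  the lower bound, so heavy cancellation in A x is the only way to fail. The constant 8 is 4 from
  \<open>lp_norm_le_block_mat\<close> times 2 for near optimality.\<close>

lemma op_norm_le_block_mat_mult:
  assumes P: "1 \<le> P" and q: "1 \<le> q" and n: "0 < n" "0 < d" and m: "0 < m" and A: "A \<in> carrier_mat n d"
  shows "M * card {g \<in> coeff_space n M. \<not> op_norm q (ereal P) A
      \<le> 8 * real m powr (1 / P) * op_norm q (ereal P) (block_mat n m (\<lambda>i. real (g i)) * A)} \<le> 2 * M ^ n"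
    (is "M * card ?bad \<le> _")
proof -
  have P': "1 \<le> ereal P" using P by (simp add: one_ereal_def)
  obtain x where x: "x \<in> carrier_vec d - {0\<^sub>v d}"
    "op_norm q (ereal P) A / 2 * lp_norm q x \<le> lp_norm (ereal P) (A *\<^sub>v x)"
    using op_norm_half_attained[OF P' q A n] .
  have xc: "x \<in> carrier_vec d" using x by simp
  define y where "y = A *\<^sub>v x"
  have y: "y \<in> carrier_vec n" unfolding y_def using A xc by (rule mult_mat_vec_carrier)
  let ?u = "\<lambda>i. \<bar>y $ i\<bar> powr P"
  have "?bad \<subseteq> {g \<in> coeff_space n M. (\<Sum>i<n. ?u i) < 2 * (\<Sum>i\<in>cancelled n m (\<lambda>i. real (g i)) y. ?u i)}"
  proof (safe, rule ccontr)
    fix g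
    let ?S = "block_mat n m (\<lambda>i. real (g i))"
    assume bad: "\<not> op_norm q (ereal P) A \<le> 8 * real m powr (1 / P) * op_norm q (ereal P) (?S * A)"
    assume "\<not> (\<Sum>i<n. ?u i) < 2 * (\<Sum>i\<in>cancelled n m (\<lambda>i. real (g i)) y. ?u i)"
    then have "lp_norm (ereal P) y \<le> 4 * real m powr (1 / P) * lp_norm (ereal P) (?S *\<^sub>v y)"
      by (intro lp_norm_le_block_mat P m y) simp
    also have "?S *\<^sub>v y = (?S * A) *\<^sub>v x"
      unfolding y_def by (rule assoc_mult_mat_vec[OF block_mat_carrier A xc, symmetric])
    also have "4 * real m powr (1 / P) * lp_norm (ereal P) ((?S * A) *\<^sub>v x)
        \<le> 4 * real m powr (1 / P) * (op_norm q (ereal P) (?S * A) * lp_norm q x)"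
      by (intro mult_left_mono lp_norm_mult_le_op_norm[OF P' q mult_carrier_mat[OF block_mat_carrier A] nblocks_pos n(2) xc]) simp
    finally have "op_norm q (ereal P) A / 2 * lp_norm q x
        \<le> 4 * real m powr (1 / P) * op_norm q (ereal P) (?S * A) * lp_norm q x"
      using x(2) unfolding y_def by (simp add: mult_ac)
    then have "op_norm q (ereal P) A / 2 \<le> 4 * real m powr (1 / P) * op_norm q (ereal P) (?S * A)"
      using lp_norm_pos[OF q x(1)] by (rule mult_right_le_imp_le)
    then show False using bad by simp
  qed
  then have "card ?bad \<le> card {g \<in> coeff_space n M. (\<Sum>i<n. ?u i) < 2 * (\<Sum>i\<in>cancelled n m (\<lambda>i. real (g i)) y. ?u i)}"
    using finite_coeff_space by (intro card_mono) auto
  then have "M * card ?bad \<le> M * card {g \<in> coeff_space n M. (\<Sum>i<n. ?u i) < 2 * (\<Sum>i\<in>cancelled n m (\<lambda>i. real (g i)) y. ?u i)}"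
    by (rule mult_le_mono2)
  also have "\<dots> \<le> 2 * M ^ n" by (rule card_coeff_space_heavily_cancelled[OF y]) simp
  finally show ?thesis .
qed

text \<open>Again \<open>x\<close> is fixed first. The cancellation now concerns the row of
  \<open>B\<close>, while \<open>x\<close> enters through the weights.\<close>

lemma op_norm_le_mult_transpose_block_mat:
  assumes p: "1 \<le> p" and Q: "1 \<le> Q" and n: "0 < n" and b: "0 < b" and B: "B \<in> carrier_mat 1 n"
  shows "M * card {h \<in> coeff_space n M. \<not> op_norm (ereal Q) p B
      \<le> 8 * real b powr (1 - 1 / Q) * op_norm (ereal Q) p (B * transpose_mat (block_mat n b (\<lambda>i. real (h i))))} \<le> 2 * M ^ n"
    (is "M * card ?bad \<le> _")
proof -
  have Q': "1 \<le> ereal Q" using Q by (simp add: one_ereal_def)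
  obtain x where x: "x \<in> carrier_vec n - {0\<^sub>v n}"
    "op_norm (ereal Q) p B / 2 * lp_norm (ereal Q) x \<le> lp_norm p (B *\<^sub>v x)"
    using op_norm_half_attained[OF p Q' B _ n] by auto
  have xc: "x \<in> carrier_vec n" using x by simp
  have v: "row B 0 \<in> carrier_vec n" using B by auto
  let ?u = "\<lambda>j. \<bar>row B 0 $ j * x $ j\<bar>"
  have "?bad \<subseteq> {h \<in> coeff_space n M. (\<Sum>j<n. ?u j) < 2 * (\<Sum>j\<in>cancelled n b (\<lambda>i. real (h i)) (row B 0). ?u j)}"
  proof (safe, rule ccontr)
    fix h
    let ?T = "transpose_mat (block_mat n b (\<lambda>i. real (h i)))"
    assume bad: "\<not> op_norm (ereal Q) p B \<le> 8 * real b powr (1 - 1 / Q) * op_norm (ereal Q) p (B * ?T)"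
    assume "\<not> (\<Sum>j<n. ?u j) < 2 * (\<Sum>j\<in>cancelled n b (\<lambda>i. real (h i)) (row B 0). ?u j)"
    then have "lp_norm p (B *\<^sub>v x)
        \<le> 4 * real b powr (1 - 1 / Q) * op_norm (ereal Q) p (B * ?T) * lp_norm (ereal Q) x"
      by (intro lp_norm_row_mult_le p Q b n B xc) simp
    then have "op_norm (ereal Q) p B / 2 * lp_norm (ereal Q) x
        \<le> 4 * real b powr (1 - 1 / Q) * op_norm (ereal Q) p (B * ?T) * lp_norm (ereal Q) x"
      using x(2) by linarith
    then have "op_norm (ereal Q) p B / 2 \<le> 4 * real b powr (1 - 1 / Q) * op_norm (ereal Q) p (B * ?T)"
      using lp_norm_pos[OF Q' x(1)] by (rule mult_right_le_imp_le)
    then show False using bad by simp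
  qed
  then have "card ?bad \<le> card {h \<in> coeff_space n M. (\<Sum>j<n. ?u j) < 2 * (\<Sum>j\<in>cancelled n b (\<lambda>i. real (h i)) (row B 0). ?u j)}"
    using finite_coeff_space by (intro card_mono) auto
  then have "M * card ?bad \<le> M * card {h \<in> coeff_space n M. (\<Sum>j<n. ?u j) < 2 * (\<Sum>j\<in>cancelled n b (\<lambda>i. real (h i)) (row B 0). ?u j)}"
    by (rule mult_le_mono2)
  also have "\<dots> \<le> 2 * M ^ n" by (rule card_coeff_space_heavily_cancelled[OF v]) simp
  finally show ?thesis .
qed

section \<open>Sketching families\<close>

text \<open>Here \<open>v\<close> is the norm sought, \<open>v'\<close> its version for finite
  exponents and \<open>u\<close> the norm of the sketch. As \<open>u\<close> lies between v / (2 D)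
  and 2 U v, the rescaled value is at most \<alpha> v / 2 and at least \<alpha> v / (8 U D), which
  exceeds v / \<alpha> by the hypothesis on \<open>8 * U * D\<close>.\<close>

lemma rescaled_estimate_in_approx_interval:
  fixes \<alpha> u v v' U D :: real
  assumes "0 \<le> v" "1 < \<alpha>" "0 < U" "0 < D" "8 * U * D < \<alpha> ^ 2"
    "v \<le> 2 * v'" "v' \<le> 2 * v" "u \<le> U * v'" "v' \<le> D * u"
  shows "\<alpha> / (4 * U) * u \<in> approx_interval \<alpha> v"
proof (cases "v = 0")
  case True
  then have "u = 0" using assms by (auto simp: zero_le_mult_iff intro: antisym)
  then show ?thesis using True by (simp add: approx_interval_def)
next
  case False
  then have v: "0 < v" using assms by simp
  have "u \<le> U * (2 * v)" using assms mult_left_mono[OF assms(7), of U] by linarith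
  then have "\<alpha> / (4 * U) * u \<le> \<alpha> / (4 * U) * (U * (2 * v))"
    using assms by (intro mult_left_mono) auto
  also have "\<dots> = \<alpha> * v / 2" using assms by (simp add: field_simps)
  also have "\<dots> < \<alpha> * v" using v assms by simp
  finally have upper: "\<alpha> / (4 * U) * u < \<alpha> * v" .
  have "v \<le> 2 * (D * u)" using assms by linarith
  then have u: "v / (2 * D) \<le> u" using assms by (simp add: field_simps)
  have "v * (8 * U * D) < v * \<alpha> ^ 2" using v assms by (intro mult_strict_left_mono) auto
  then have "v / \<alpha> < \<alpha> / (4 * U) * (v / (2 * D))"
    using assms by (simp add: field_simps power2_eq_square)
  also have "\<dots> \<le> \<alpha> / (4 * U) * u" using u assms by (intro mult_left_mono) auto
  finally show ?thesis using upper False assms by (simp add: approx_interval_def)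
qed

text \<open>The upper bound holds for every outcome, so the permitted failure probability 1/6 is
  spent on the lower bound alone.\<close>

lemma sketching_family_of_distortion:
  fixes S T :: "'w \<Rightarrow> real mat"
  assumes pq: "1 \<le> p" "1 \<le> q" and n: "1 \<le> n" and rs: "0 < r" "0 < s"
    and \<Omega>: "finite \<Omega>" "\<Omega> \<noteq> {}"
    and ST: "\<And>\<omega>. \<omega> \<in> \<Omega> \<Longrightarrow> S \<omega> \<in> carrier_mat r n" "\<And>\<omega>. \<omega> \<in> \<Omega> \<Longrightarrow> T \<omega> \<in> carrier_mat n s"
    and \<alpha>: "1 < \<alpha>" and UD: "0 < U" "0 < D" "8 * U * D < \<alpha> ^ 2"
  defines "op' \<equiv> op_norm (ereal (finite_exponent n q)) (ereal (finite_exponent n p))"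
  assumes upper: "\<And>\<omega> A. \<omega> \<in> \<Omega> \<Longrightarrow> A \<in> carrier_mat n n \<Longrightarrow> op' (S \<omega> * A * T \<omega>) \<le> U * op' A"
    and lower: "\<And>A. A \<in> carrier_mat n n \<Longrightarrow>
      6 * card {\<omega> \<in> \<Omega>. \<not> op' A \<le> D * op' (S \<omega> * A * T \<omega>)} \<le> card \<Omega>"
  shows "\<exists>\<S> f. sketching_family n n (r * s) \<alpha> q p \<S> f"
proof -
  have pq': "1 \<le> ereal (finite_exponent n p)" "1 \<le> ereal (finite_exponent n q)"
    using finite_exponent_ge_1 pq n by (auto simp: one_ereal_def)
  define f where "f = (\<lambda>w. \<alpha> / (4 * U) * op' (unflatten r s w))"
  have "\<exists>\<S>. sketching_family n n (r * s) \<alpha> q p \<S> f"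
  proof (rule sketching_familyI[OF \<Omega>, of "\<lambda>\<omega>. sketch_map n (S \<omega>) (T \<omega>)"])
    show "sketch_map n (S \<omega>) (T \<omega>) \<in> linear_maps n n (r * s)" if "\<omega> \<in> \<Omega>" for \<omega>
      using sketch_map_linear ST that by blast
    show "(\<lambda>L. f (L A)) \<in> borel_measurable (linear_maps_borel n n (r * s))"
      if "A \<in> carrier_mat n n" for A
      unfolding f_def op'_def
      by (intro borel_measurable_times borel_measurable_const measurable_op_norm_unflatten pq' rs that)
    fix A :: "real mat" assume A: "A \<in> carrier_mat n n"
    let ?bad = "{\<omega> \<in> \<Omega>. \<not> op' A \<le> D * op' (S \<omega> * A * T \<omega>)}"
    let ?good = "{\<omega> \<in> \<Omega>. f (sketch_map n (S \<omega>) (T \<omega>) A) \<in> approx_interval \<alpha> (op_norm q p A)}"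
    have "\<Omega> - ?bad \<subseteq> ?good"
    proof
      fix \<omega> assume "\<omega> \<in> \<Omega> - ?bad"
      then have \<omega>: "\<omega> \<in> \<Omega>" "op' A \<le> D * op' (S \<omega> * A * T \<omega>)" by auto
      have "f (sketch_map n (S \<omega>) (T \<omega>) A) = \<alpha> / (4 * U) * op' (S \<omega> * A * T \<omega>)"
        unfolding f_def unflatten_sketch_map[OF ST[OF \<omega>(1)] A] ..
      also have "\<dots> \<in> approx_interval \<alpha> (op_norm q p A)"
      proof (rule rescaled_estimate_in_approx_interval[OF _ \<alpha> UD, where v' = "op' A"])
        show "0 \<le> op_norm q p A" using op_norm_nonneg[OF pq A] n by simp
        show "op_norm q p A \<le> 2 * op' A" "op' A \<le> 2 * op_norm q p A"
          unfolding op'_def using op_norm_finite_exponent[OF pq A n] by auto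
      qed (use upper \<omega> A in auto)
      finally show "\<omega> \<in> ?good" using \<omega> by simp
    qed
    then have "card (\<Omega> - ?bad) \<le> card ?good" using \<Omega> by (intro card_mono) auto
    moreover have "card (\<Omega> - ?bad) = card \<Omega> - card ?bad" using \<Omega> by (intro card_Diff_subset) auto
    ultimately show "5 / 6 * real (card \<Omega>) \<le> real (card ?good)"
      using lower[OF A] by linarith
  qed
  then show ?thesis by blast
qed

text \<open>Reading all entries is affordable for bounded \<alpha>. The estimate is exact, so it
  also hits the one-point target for \<alpha> = 1.\<close>

lemma sketching_family_identity:
  assumes pq: "1 \<le> p" "1 \<le> q" and n: "1 \<le> n" and \<alpha>: "1 \<le> \<alpha>"
  shows "\<exists>\<S> f. sketching_family n n (n * n) \<alpha> q p \<S> f"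
proof -
  define f where "f = (\<lambda>w. op_norm q p (unflatten n n w))"
  have n0: "0 < n" using n by simp
  have "\<exists>\<S>. sketching_family n n (n * n) \<alpha> q p \<S> f"
  proof (rule sketching_familyI[of "{()}" "\<lambda>_. sketch_map n (1\<^sub>m n) (1\<^sub>m n)"])
    show "sketch_map n (1\<^sub>m n) (1\<^sub>m n) \<in> linear_maps n n (n * n)"
      by (rule sketch_map_linear) auto
    fix A :: "real mat" assume A: "A \<in> carrier_mat n n"
    show "(\<lambda>L. f (L A)) \<in> borel_measurable (linear_maps_borel n n (n * n))"
      unfolding f_def by (rule measurable_op_norm_unflatten[OF pq n0 n0 A])
    have "f (sketch_map n (1\<^sub>m n) (1\<^sub>m n) A) = op_norm q p A"
      unfolding f_def using A by (simp add: unflatten_sketch_map[OF one_carrier_mat one_carrier_mat A])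
    moreover have "op_norm q p A \<in> approx_interval \<alpha> (op_norm q p A)"
    proof -
      have "0 \<le> op_norm q p A" by (rule op_norm_nonneg[OF pq A n0 n0])
      then show ?thesis using \<alpha> by (auto simp: approx_interval_def divide_less_eq)
    qed
    ultimately show "5 / 6 * real (card {()})
        \<le> real (card {\<omega> \<in> {()}. f (sketch_map n (1\<^sub>m n) (1\<^sub>m n) A) \<in> approx_interval \<alpha> (op_norm q p A)})"
      by simp
  qed auto
  then show ?thesis by blast
qed

lemma coeff_space_abs_le:
  assumes "g \<in> coeff_space n M" "i < n"
  shows "\<bar>real (g i)\<bar> \<le> real M"
proof -
  have "g i < M" using assms by (auto simp: coeff_space_def)
  then show ?thesis by simp
qed

lemma powr_mult_powr_complement:
  assumes "0 < x"
  shows "x powr (1 - 1 / P) * x powr (1 / P) = (x :: real)"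
  using assms by (simp flip: powr_add)

text \<open>The product 8 * U * D is 8 * (24 * 8) * m in the first and 8 * (24^2 * 8^2) * (n * b) in the
  second of the following lemmas, which explains the constant 300000. The 24 coefficient values make each of the at most two random steps fail with probability at
  most 1/12.\<close>

lemma sketching_family_rows:
  assumes pq: "1 \<le> p" "1 \<le> q" and n: "1 \<le> n" and m: "1 \<le> m" and \<alpha>: "1 < \<alpha>" "300000 * real m \<le> \<alpha> ^ 2"
  shows "\<exists>\<S> f. sketching_family n n (nblocks n m * n) \<alpha> q p \<S> f"
proof (rule sketching_family_of_distortion[OF pq n nblocks_pos])
  define P where "P = finite_exponent n p"
  define q' where "q' = ereal (finite_exponent n q)"
  have P: "1 \<le> P" "1 \<le> ereal P" and q': "1 \<le> q'"
    using finite_exponent_ge_1 pq n by (auto simp: one_ereal_def P_def q'_def)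
  have nm: "0 < n" "0 < m" using n m by auto
  let ?S = "\<lambda>g :: nat \<Rightarrow> nat. block_mat n m (\<lambda>i. real (g i))" and ?T = "\<lambda>g :: nat \<Rightarrow> nat. 1\<^sub>m n :: real mat"
  let ?U = "real 24 * real m powr (1 - 1 / P)" and ?D = "8 * real m powr (1 / P)"
  show "0 < n" by (rule nm)
  show "finite (coeff_space n 24)" by (rule finite_coeff_space)
  have "card (coeff_space n 24) \<noteq> 0" by (simp add: card_coeff_space)
  then show "coeff_space n 24 \<noteq> {}" by auto
  show "?S g \<in> carrier_mat (nblocks n m) n" "?T g \<in> carrier_mat n n" for g by auto
  show "1 < \<alpha>" "0 < ?U" "0 < ?D" using \<alpha> nm by auto
  have "8 * ?U * ?D = 1536 * (real m powr (1 - 1 / P) * real m powr (1 / P))" by simp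
  also have "\<dots> = 1536 * real m" using nm by (subst powr_mult_powr_complement) auto
  finally show "8 * ?U * ?D < \<alpha> ^ 2" using \<alpha> nm by simp
  fix A :: "real mat" assume A: "A \<in> carrier_mat n n"
  have T: "?S g * A * ?T g = ?S g * A" for g
    using mult_carrier_mat[OF block_mat_carrier A] by (rule right_mult_one_mat)
  show "op_norm (ereal (finite_exponent n q)) (ereal (finite_exponent n p)) (?S g * A * ?T g)
      \<le> ?U * op_norm (ereal (finite_exponent n q)) (ereal (finite_exponent n p)) A"
    if g: "g \<in> coeff_space n 24" for g
    unfolding T P_def[symmetric] q'_def[symmetric]
  proof (rule op_norm_mult_left_le[OF P(2) q' A nm(1) nm(1) block_mat_carrier])
    fix y :: "real vec" assume "y \<in> carrier_vec n"
    then show "lp_norm (ereal P) (?S g *\<^sub>v y) \<le> ?U * lp_norm (ereal P) y"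
      by (intro lp_norm_block_mat_le P nm coeff_space_abs_le[OF g]) auto
  qed simp
  show "6 * card {g \<in> coeff_space n 24. \<not> op_norm (ereal (finite_exponent n q)) (ereal (finite_exponent n p)) A
        \<le> ?D * op_norm (ereal (finite_exponent n q)) (ereal (finite_exponent n p)) (?S g * A * ?T g)}
      \<le> card (coeff_space n 24)"
    using op_norm_le_block_mat_mult[OF P(1) q' nm(1) nm(1) nm(2) A, of 24]
    unfolding T P_def[symmetric] q'_def[symmetric] card_coeff_space by linarith
qed

text \<open>All rows form a single block, which leaves one row; then the columns of that row are
  compressed. The exponents \<open>P\<close> and \<open>Q\<close> drop out of the product of the
  distortions.\<close>

lemma sketching_family_rows_columns:
  assumes pq: "1 \<le> p" "1 \<le> q" and n: "1 \<le> n" and b: "1 \<le> b" and \<alpha>: "1 < \<alpha>" "300000 * (real n * real b) \<le> \<alpha> ^ 2"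
  shows "\<exists>\<S> f. sketching_family n n (1 * nblocks n b) \<alpha> q p \<S> f"
proof (rule sketching_family_of_distortion[OF pq n _ nblocks_pos])
  define P where "P = finite_exponent n p"
  define Q where "Q = finite_exponent n q"
  have P: "1 \<le> P" "1 \<le> ereal P" and Q: "1 \<le> Q" "1 \<le> ereal Q"
    using finite_exponent_ge_1 pq n by (auto simp: one_ereal_def P_def Q_def)
  have nb: "0 < n" "0 < b" using n b by auto
  have n1: "nblocks n n = 1" using nb by (simp add: nblocks_def)
  let ?\<Omega> = "coeff_space n 24 \<times> coeff_space n 24"
  let ?S = "\<lambda>\<omega> :: (nat \<Rightarrow> nat) \<times> (nat \<Rightarrow> nat). block_mat n n (\<lambda>i. real (fst \<omega> i))"
  let ?T = "\<lambda>\<omega> :: (nat \<Rightarrow> nat) \<times> (nat \<Rightarrow> nat). transpose_mat (block_mat n b (\<lambda>i. real (snd \<omega> i)))"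
  let ?U1 = "real 24 * real n powr (1 - 1 / P)" and ?U2 = "real 24 * real b powr (1 / Q)"
  let ?D1 = "8 * real n powr (1 / P)" and ?D2 = "8 * real b powr (1 - 1 / Q)"
  show "0 < (1::nat)" by simp
  show "finite ?\<Omega>" by (intro finite_cartesian_product finite_coeff_space)
  have "card (coeff_space n 24) \<noteq> 0" by (simp add: card_coeff_space)
  then show "?\<Omega> \<noteq> {}" by auto
  have S: "?S \<omega> \<in> carrier_mat 1 n" for \<omega> using block_mat_carrier[of n n] unfolding n1 .
  have T: "?T \<omega> \<in> carrier_mat n (nblocks n b)" for \<omega>
    using block_mat_carrier by (rule transpose_carrier_mat[THEN iffD2])
  show "?S \<omega> \<in> carrier_mat 1 n" "?T \<omega> \<in> carrier_mat n (nblocks n b)" for \<omega>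
    by (rule S, rule T)
  show "1 < \<alpha>" "0 < ?U1 * ?U2" "0 < ?D1 * ?D2" using \<alpha> nb by auto
  have "8 * (?U1 * ?U2) * (?D1 * ?D2) = 294912 * ((real n powr (1 - 1 / P) * real n powr (1 / P)) *
      (real b powr (1 - 1 / Q) * real b powr (1 / Q)))" by simp
  also have "\<dots> = 294912 * (real n * real b)" using nb by (simp add: powr_mult_powr_complement)
  also have "\<dots> < \<alpha> ^ 2"
  proof -
    have "0 < real n * real b" using nb by simp
    then show ?thesis using \<alpha> by linarith
  qed
  finally show "8 * (?U1 * ?U2) * (?D1 * ?D2) < \<alpha> ^ 2" .
  fix A :: "real mat" assume A: "A \<in> carrier_mat n n"
  let ?op = "op_norm (ereal Q) (ereal P)"
  have SA: "?S \<omega> * A \<in> carrier_mat 1 n" for \<omega> by (rule mult_carrier_mat[OF S A])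
  show "op_norm (ereal (finite_exponent n q)) (ereal (finite_exponent n p)) (?S \<omega> * A * ?T \<omega>)
      \<le> (?U1 * ?U2) * op_norm (ereal (finite_exponent n q)) (ereal (finite_exponent n p)) A"
    if \<omega>: "\<omega> \<in> ?\<Omega>" for \<omega>
    unfolding P_def[symmetric] Q_def[symmetric]
  proof -
    have g: "fst \<omega> \<in> coeff_space n 24" and h: "snd \<omega> \<in> coeff_space n 24" using \<omega> by auto
    have "?op (?S \<omega> * A * ?T \<omega>) \<le> ?U2 * ?op (?S \<omega> * A)"
    proof (rule op_norm_mult_right_le[OF P(2) Q(2) SA _ nb(1) nblocks_pos T])
      fix z :: "real vec" assume "z \<in> carrier_vec (nblocks n b)"
      then show "lp_norm (ereal Q) (?T \<omega> *\<^sub>v z) \<le> ?U2 * lp_norm (ereal Q) z"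
        by (intro lp_norm_transpose_block_mat_le Q nb coeff_space_abs_le[OF h]) auto
    qed simp
    also have "?U2 * ?op (?S \<omega> * A) \<le> ?U2 * (?U1 * ?op A)"
    proof (intro mult_left_mono op_norm_mult_left_le[OF P(2) Q(2) A nb(1) nb(1) S])
      fix y :: "real vec" assume "y \<in> carrier_vec n"
      then show "lp_norm (ereal P) (?S \<omega> *\<^sub>v y) \<le> ?U1 * lp_norm (ereal P) y"
        by (intro lp_norm_block_mat_le P nb coeff_space_abs_le[OF g]) auto
    qed simp_all
    finally show "?op (?S \<omega> * A * ?T \<omega>) \<le> (?U1 * ?U2) * ?op A" by (simp only: mult_ac)
  qed
  let ?N = "24 ^ n :: nat"
  let ?bad1 = "{g \<in> coeff_space n 24. \<not> ?op A \<le> ?D1 * ?op (block_mat n n (\<lambda>i. real (g i)) * A)}"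
  let ?bad2 = "\<lambda>g. {h \<in> coeff_space n 24. \<not> ?op (block_mat n n (\<lambda>i. real (g i)) * A)
      \<le> ?D2 * ?op (block_mat n n (\<lambda>i. real (g i)) * A * transpose_mat (block_mat n b (\<lambda>i. real (h i))))}"
  let ?bad = "{\<omega> \<in> ?\<Omega>. \<not> ?op A \<le> (?D1 * ?D2) * ?op (?S \<omega> * A * ?T \<omega>)}"
  have fin: "finite ?bad1" "finite (?bad2 g)" for g using finite_coeff_space by auto
  \<comment> \<open>A union bound over the two steps. The failures of the column step are counted
    for each \<open>g\<close> separately, with the row S A held fixed.\<close>
  have "?bad \<subseteq> ?bad1 \<times> coeff_space n 24 \<union> Sigma (coeff_space n 24) ?bad2"
  proof
    fix \<omega> assume "\<omega> \<in> ?bad"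
    then obtain g h where \<omega>: "\<omega> = (g, h)" "g \<in> coeff_space n 24" "h \<in> coeff_space n 24"
      and bad: "\<not> ?op A \<le> (?D1 * ?D2) * ?op (?S (g, h) * A * ?T (g, h))" by auto
    show "\<omega> \<in> ?bad1 \<times> coeff_space n 24 \<union> Sigma (coeff_space n 24) ?bad2"
    proof (rule ccontr)
      assume "\<omega> \<notin> ?bad1 \<times> coeff_space n 24 \<union> Sigma (coeff_space n 24) ?bad2"
      then have *: "?op A \<le> ?D1 * ?op (?S (g, h) * A)"
        "?op (?S (g, h) * A) \<le> ?D2 * ?op (?S (g, h) * A * ?T (g, h))"
        using \<omega> by simp_all
      have "?D1 * ?op (?S (g, h) * A) \<le> ?D1 * (?D2 * ?op (?S (g, h) * A * ?T (g, h)))"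
        using *(2) by (rule mult_left_mono) simp
      with *(1) bad show False by (simp add: mult.assoc)
    qed
  qed
  then have "card ?bad \<le> card (?bad1 \<times> coeff_space n 24 \<union> Sigma (coeff_space n 24) ?bad2)"
    using fin finite_coeff_space by (intro card_mono) auto
  also have "\<dots> \<le> card (?bad1 \<times> coeff_space n 24) + card (Sigma (coeff_space n 24) ?bad2)"
    by (rule card_Un_le)
  also have "\<dots> = card ?bad1 * ?N + (\<Sum>g\<in>coeff_space n 24. card (?bad2 g))"
    using fin finite_coeff_space by (subst card_SigmaI) (auto simp: card_cartesian_product card_coeff_space)
  finally have "12 * card ?bad \<le> (12 * card ?bad1) * ?N + (\<Sum>g\<in>coeff_space n 24. 12 * card (?bad2 g))"
    by (simp add: sum_distrib_left[symmetric])
  also have "\<dots> \<le> ?N * ?N + (\<Sum>g\<in>coeff_space n 24. ?N)"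
  proof (intro add_mono mult_le_mono1 sum_mono)
    show "12 * card ?bad1 \<le> ?N"
      using op_norm_le_block_mat_mult[OF P(1) Q(2) nb(1) nb(1) nb(1) A, of 24] by linarith
    \<comment> \<open>The row depends on the first component of the outcome only, so
      \<open>(g, g)\<close> represents it.\<close>
    show "12 * card (?bad2 g) \<le> ?N" for g
      using op_norm_le_mult_transpose_block_mat[OF P(2) Q(1) nb SA[of "(g, g)"], of 24]
      unfolding fst_conv by linarith
  qed
  also have "\<dots> = 2 * card ?\<Omega>" by (simp add: card_cartesian_product card_coeff_space)
  finally show "6 * card {\<omega> \<in> ?\<Omega>. \<not> op_norm (ereal (finite_exponent n q)) (ereal (finite_exponent n p)) A
        \<le> (?D1 * ?D2) * op_norm (ereal (finite_exponent n q)) (ereal (finite_exponent n p)) (?S \<omega> * A * ?T \<omega>)}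
      \<le> card ?\<Omega>"
    unfolding P_def[symmetric] Q_def[symmetric] by linarith
qed

section \<open>Choice of the block sizes\<close>

lemma nblocks_le:
  assumes "0 < m" "m \<le> n"
  shows "real (nblocks n m) \<le> 2 * real n / real m"
proof -
  have "real ((n - 1) div m) \<le> real (n - 1) / real m" by (rule of_nat_div_le_of_nat)
  also have "\<dots> \<le> real n / real m" by (intro divide_right_mono) auto
  finally have "real (nblocks n m) \<le> real n / real m + 1" by (simp add: nblocks_def)
  moreover have "1 \<le> real n / real m" using assms by simp
  ultimately show ?thesis by simp
qed

lemma nat_floor_bounds:
  fixes x :: real
  assumes "1 \<le> x"
  shows "1 \<le> nat \<lfloor>x\<rfloor>" "real (nat \<lfloor>x\<rfloor>) \<le> x" "x \<le> 2 * real (nat \<lfloor>x\<rfloor>)"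
proof -
  have "1 \<le> \<lfloor>x\<rfloor>" using assms by simp
  then show "1 \<le> nat \<lfloor>x\<rfloor>" by linarith
  have eq: "real (nat \<lfloor>x\<rfloor>) = of_int \<lfloor>x\<rfloor>" using \<open>1 \<le> \<lfloor>x\<rfloor>\<close> by simp
  show "real (nat \<lfloor>x\<rfloor>) \<le> x" unfolding eq by simp
  show "x \<le> 2 * real (nat \<lfloor>x\<rfloor>)"
    using \<open>1 \<le> \<lfloor>x\<rfloor>\<close> real_of_int_floor_gt_diff_one[of x] unfolding eq by linarith
qed

text \<open>Three ranges of \<alpha> lead to the identity, to blocks of rows of size about
  \<alpha>^2 / 300000, and to a single row with column blocks of size about \<alpha>^2 / (300000 n).
  The constant 1200000 is 300000 times 2 for rounding the block size down and 2 for rounding the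
  number of blocks up.\<close>

lemma sketching_family_exists:
  assumes pq: "1 \<le> p" "1 \<le> q" and n: "1 \<le> n" and \<alpha>: "1 \<le> \<alpha>"
  shows "\<exists>k \<S> f. real k \<le> max 1 (1200000 * (real n ^ 2 / \<alpha> ^ 2)) \<and> sketching_family n n k \<alpha> q p \<S> f"
proof -
  let ?C = "300000 :: real"
  have n0: "0 < real n" using n by simp
  have \<alpha>0: "0 < \<alpha> ^ 2" using \<alpha> by simp
  consider "\<alpha> ^ 2 < ?C" | "?C \<le> \<alpha> ^ 2" "\<alpha> ^ 2 \<le> ?C * real n" | "?C \<le> \<alpha> ^ 2" "?C * real n < \<alpha> ^ 2"
    by linarith
  then show ?thesis
  proof cases
    case 1
    have "real n ^ 2 * \<alpha> ^ 2 \<le> real n ^ 2 * 1200000" using 1 by (intro mult_left_mono) auto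
    then have "real (n * n) \<le> 1200000 * (real n ^ 2 / \<alpha> ^ 2)"
      using \<alpha>0 by (simp add: le_divide_eq power2_eq_square mult_ac)
    then show ?thesis using sketching_family_identity[OF pq n \<alpha>] by (intro exI[of _ "n * n"]) auto
  next
    case 2
    have \<alpha>1: "1 < \<alpha>" using 2 \<alpha> by (cases "\<alpha> = 1") auto
    define m where "m = nat \<lfloor>\<alpha> ^ 2 / ?C\<rfloor>"
    have m: "1 \<le> m" "real m \<le> \<alpha> ^ 2 / ?C" "\<alpha> ^ 2 / ?C \<le> 2 * real m"
      unfolding m_def using 2 by (intro nat_floor_bounds; simp)+
    have mn: "m \<le> n" using m(2) 2(2) by simp
    have m0: "0 < real m" using m by simp
    have "real (nblocks n m) * real n \<le> 2 * real n / real m * real n"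
      using nblocks_le[of m n] m mn by (intro mult_right_mono) auto
    also have "\<dots> \<le> 1200000 * (real n ^ 2 / \<alpha> ^ 2)"
    proof -
      have "1 / real m \<le> 600000 / \<alpha> ^ 2"
        using m(3) by (simp add: pos_le_divide_eq[OF \<alpha>0] pos_divide_le_eq[OF m0] mult.commute)
      then have "(2 * real n ^ 2) * (1 / real m) \<le> (2 * real n ^ 2) * (600000 / \<alpha> ^ 2)"
        by (rule mult_left_mono) simp
      then show ?thesis by (simp add: power2_eq_square)
    qed
    finally show ?thesis
      using sketching_family_rows[OF pq n m(1) \<alpha>1] m(2)
      by (intro exI[of _ "nblocks n m * n"]) (auto simp: field_simps)
  next
    case 3
    have \<alpha>1: "1 < \<alpha>" using 3 \<alpha> by (cases "\<alpha> = 1") auto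
    define c where "c = nat \<lfloor>\<alpha> ^ 2 / (?C * real n)\<rfloor>"
    have "1 \<le> \<alpha> ^ 2 / (?C * real n)" using 3 n0 by (simp add: le_divide_eq)
    note c = nat_floor_bounds[OF this, folded c_def]
    \<comment> \<open>A block of columns cannot usefully exceed \<open>n\<close>. If the cap is
      attained, one coordinate remains; this is where \<open>max 1\<close> enters the bound.\<close>
    define b where "b = min n c"
    have b: "1 \<le> b" "b \<le> n" "b \<le> c" using n c(1) by (auto simp: b_def)
    have "real b \<le> \<alpha> ^ 2 / (?C * real n)" using b(3) c(2) by linarith
    then have "?C * (real n * real b) \<le> \<alpha> ^ 2" using n0 by (simp add: le_divide_eq mult_ac)
    note fam = sketching_family_rows_columns[OF pq n b(1) \<alpha>1 this]
    have "real (nblocks n b) \<le> max 1 (1200000 * (real n ^ 2 / \<alpha> ^ 2))"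
    proof (cases "b = n")
      case True
      then show ?thesis using n by (simp add: nblocks_def)
    next
      case False
      then have "b = c" by (auto simp: b_def min_def split: if_splits)
      have c0: "0 < real c" using c(1) by simp
      have "real (nblocks n b) \<le> 2 * real n / real c"
        using nblocks_le[of b n] b \<open>b = c\<close> by simp
      also have "\<dots> \<le> 1200000 * (real n ^ 2 / \<alpha> ^ 2)"
      proof -
        have "\<alpha> ^ 2 \<le> 600000 * (real n * real c)" using c(3) n0 by (simp add: divide_le_eq mult_ac)
        then have "1 / real c \<le> 600000 * real n / \<alpha> ^ 2"
          by (simp add: pos_le_divide_eq[OF \<alpha>0] pos_divide_le_eq[OF c0] mult_ac)
        then have "(2 * real n) * (1 / real c) \<le> (2 * real n) * (600000 * real n / \<alpha> ^ 2)"
          by (rule mult_left_mono) simp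
        then show ?thesis by (simp add: power2_eq_square)
      qed
      finally show ?thesis by simp
    qed
    then show ?thesis using fam by (intro exI[of _ "nblocks n b"]) auto
  qed
qed

theorem theorem1p3:
  shows "\<exists>C::real. C > 0 \<and>
    (\<forall>(n::nat) (\<alpha>::real). n \<ge> 1 \<longrightarrow> \<alpha> \<ge> 1 \<longrightarrow>
      (\<forall>p::ereal. 1 \<le> p \<longrightarrow>
        (\<exists>k S f. real k \<le> max 1 (C * (real n ^ 2 / \<alpha>)) \<and> sketching_family n n k \<alpha> 2 p S f) \<and>
        (\<exists>k S f. real k \<le> max 1 (C * (real n ^ 2 / \<alpha>)) \<and> sketching_family n n k \<alpha> \<infinity> p S f)) \<and>
      (\<forall>(q::ereal) (p::ereal). 1 \<le> q \<longrightarrow> 1 \<le> p \<longrightarrow> p \<le> 2 \<longrightarrow>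
        (\<exists>k S f. real k \<le> max 1 (C * (real n ^ 2 / \<alpha> ^ 2)) \<and> sketching_family n n k \<alpha> q p S f)))"
proof -
  \<comment> \<open>The bound with \<alpha>^2 holds for all pairs of exponents, and \<alpha> \<le>
    \<alpha>^2 turns it into the weaker one.\<close>
  have weaken: "\<exists>k S f. real k \<le> max 1 (1200000 * (real n ^ 2 / \<alpha>)) \<and> sketching_family n n k \<alpha> q p S f"
    if "1 \<le> n" "1 \<le> \<alpha>" "1 \<le> p" "1 \<le> q" for n :: nat and \<alpha> :: real and p q :: ereal
  proof -
    have "1200000 * (real n ^ 2 / \<alpha> ^ 2) \<le> 1200000 * (real n ^ 2 / \<alpha>)"
      using that(2) by (intro mult_left_mono divide_left_mono) (auto simp: power2_eq_square)
    then have "max 1 (1200000 * (real n ^ 2 / \<alpha> ^ 2)) \<le> max 1 (1200000 * (real n ^ 2 / \<alpha>))"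
      by (rule max.mono[OF order_refl])
    then show ?thesis using sketching_family_exists[OF that(3,4,1,2)] order_trans by blast
  qed
  have "(1::ereal) \<le> 2" "(1::ereal) \<le> \<infinity>" by auto
  then show ?thesis
    by (intro exI[of _ "1200000 :: real"] conjI allI impI weaken sketching_family_exists) auto
qed

end
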